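(* Let $\Gamma$ be a groupoid and $H\subseteq\Gamma^1$ a set of morphisms that generates $\Gamma$, and let $X$ be an object. Then $\mathcal P(\Gamma,H,X)$ is a covering space of $\mathcal N(\Gamma,H)$ via the map sending a simplex $[\varphi_0,\dots,\varphi_n]$ to the simplex with objects $t(\varphi_0),\dots,t(\varphi_n)$ and morphisms $\varphi_j\circ\varphi_i^{-1}$. If $\mathcal P(\Gamma,H,X)$ is simply connected, then the map $\omega:\pi_1(\mathcal N(\Gamma,H))\to\Gamma$ sending the class of an edge path with edges $\varphi_1,\dots,\varphi_n$ (each in $H\cup H^{-1}$) to $\varphi_n\circ\dots\circ\varphi_1$ is an isomorphism of groupoids; in particular, $H$ homotopically uniquely generates $\Gamma$.
   Context: Composition in $\Gamma$ is written right to left; $s(\varphi),t(\varphi)$ denote source and target. $H$ generates $\Gamma$ if $H$ contains all identities and every morphism is a composite of elements of $H\cup H^{-1}$. The nerve $\mathcal N(\Gamma,H)$ is the $\Delta$-complex (identified with its geometric realization) whose $n$-simplices are tuples of objects $(X_0,\dots,X_n)$ with morphisms $\varphi_{i,j}:X_i\to X_j$ in $H$ for $i<j$ such that $\varphi_{j,k}\circ\varphi_{i,j}=\varphi_{i,k}$ for $i<j<k$; faces delete an object. An edge path is a composable sequence in $H\cup H^{-1}$ (edges traversed forward or backward). $\pi_1(\mathcal N(\Gamma,H))$ is the fundamental groupoid whose objects are the vertices (objects of $\Gamma$) and whose morphisms are homotopy classes rel endpoints of paths. For morphisms $\varphi_1,\varphi_2$ with common source write $\varphi_1\to\varphi_2$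 if $\varphi_2\circ\varphi_1^{-1}\in H$. $\mathcal P(\Gamma,H,X)$ is the $\Delta$-complex whose vertices are morphisms with source $X$ and whose $n$-simplices are tuples $(\varphi_0,\dots,\varphi_n)$ of such morphisms with $\varphi_i\to\varphi_j$ for all $i<j$. $H$ homotopically uniquely generates $\Gamma$ if $H$ generates $\Gamma$ and any two composable sequences in $H\cup H^{-1}$ with the same composite are homotopic rel endpoints as paths in $\mathcal N(\Gamma,H)$.
   Formalization: As Γ may be disconnected, where the claim fails (P(Γ,H,X) sees only the component of X), ω is shown to be an isomorphism on the connected component of X, and H is shown to homotopically uniquely generate Γ when Γ is connected. *)

theory Defs
  imports "HOL-Analysis.Analysis"
begin

record ('o, 'm) groupoid =
  gobj  :: "'o set"
  gmor  :: "'m set"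
  gsrc  :: "'m \<Rightarrow> 'o"
  gtgt  :: "'m \<Rightarrow> 'o"
  gcomp :: "'m \<Rightarrow> 'm \<Rightarrow> 'm"   (* gcomp g f = g o f, defined when gtgt f = gsrc g *)
  gid   :: "'o \<Rightarrow> 'm"
  ginv  :: "'m \<Rightarrow> 'm"

definition groupoid :: "('o, 'm, 'z) groupoid_scheme \<Rightarrow> bool" where
  "groupoid G \<longleftrightarrow>
     (\<forall>f\<in>gmor G. gsrc G f \<in> gobj G \<and> gtgt G f \<in> gobj G) \<and>
     (\<forall>x\<in>gobj G. gid G x \<in> gmor G \<and> gsrc G (gid G x) = x \<and> gtgt G (gid G x) = x) \<and>
     (\<forall>f\<in>gmor G. \<forall>g\<in>gmor G. gtgt G f = gsrc G g \<longrightarrow>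
         gcomp G g f \<in> gmor G \<and> gsrc G (gcomp G g f) = gsrc G f \<and> gtgt G (gcomp G g f) = gtgt G g) \<and>
     (\<forall>f\<in>gmor G. \<forall>g\<in>gmor G. \<forall>h\<in>gmor G. gtgt G f = gsrc G g \<longrightarrow> gtgt G g = gsrc G h \<longrightarrow>
         gcomp G h (gcomp G g f) = gcomp G (gcomp G h g) f) \<and>
     (\<forall>f\<in>gmor G. gcomp G f (gid G (gsrc G f)) = f \<and> gcomp G (gid G (gtgt G f)) f = f) \<and>
     (\<forall>f\<in>gmor G. ginv G f \<in> gmor G \<and> gsrc G (ginv G f) = gtgt G f \<and> gtgt G (ginv G f) = gsrc G f \<and>
         gcomp G (ginv G f) f = gid G (gsrc G f) \<and> gcomp G f (ginv G f) = gid G (gtgt G f))"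

definition ghom :: "('o, 'm, 'z) groupoid_scheme \<Rightarrow> 'o \<Rightarrow> 'o \<Rightarrow> 'm set" where
  "ghom G x y = {f \<in> gmor G. gsrc G f = x \<and> gtgt G f = y}"

text \<open>Edge paths: a list of edges; an edge (d, f) is a morphism f of H traversed
  forward (d = True) or backward (d = False), i.e. representing f or its inverse.\<close>

definition edge_mor :: "('o, 'm, 'z) groupoid_scheme \<Rightarrow> bool \<times> 'm \<Rightarrow> 'm" where
  "edge_mor G e = (if fst e then snd e else ginv G (snd e))"

fun epath :: "('o, 'm, 'z) groupoid_scheme \<Rightarrow> 'm set \<Rightarrow> 'o \<Rightarrow> (bool \<times> 'm) list \<Rightarrow> 'o \<Rightarrow> bool" where
  "epath G H x [] y \<longleftrightarrow> x = y \<and> x \<in> gobj G"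
| "epath G H x (e # es) y \<longleftrightarrow> snd e \<in> H \<and> gsrc G (edge_mor G e) = x \<and>
      epath G H (gtgt G (edge_mor G e)) es y"

definition ecomp :: "('o, 'm, 'z) groupoid_scheme \<Rightarrow> 'o \<Rightarrow> (bool \<times> 'm) list \<Rightarrow> 'm" where
  "ecomp G x es = foldl (\<lambda>acc e. gcomp G (edge_mor G e) acc) (gid G x) es"

definition generates :: "('o, 'm, 'z) groupoid_scheme \<Rightarrow> 'm set \<Rightarrow> bool" where
  "generates G H \<longleftrightarrow> H \<subseteq> gmor G \<and> (\<forall>x\<in>gobj G. gid G x \<in> H) \<and>
     (\<forall>f\<in>gmor G. \<exists>es. epath G H (gsrc G f) es (gtgt G f) \<and> ecomp G (gsrc G f) es = f)"

text \<open>A Delta-complex is given by a set of simplices S, a dimension function dm and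
  face operators fc (fc s i deletes the i-th vertex of s).  A point of the realization is
  represented canonically as a pair (s, t) with t in the open standard simplex of dimension
  dm s (barycentric coordinates t 0, ..., t (dm s), all positive).\<close>

definition stdsimplex :: "nat \<Rightarrow> (nat \<Rightarrow> real) set" where
  "stdsimplex n = {t. (\<forall>i. 0 \<le> t i) \<and> (\<forall>i>n. t i = 0) \<and> (\<Sum>i\<le>n. t i) = 1}"

definition ostdsimplex :: "nat \<Rightarrow> (nat \<Rightarrow> real) set" where
  "ostdsimplex n = {t \<in> stdsimplex n. \<forall>i\<le>n. 0 < t i}"

text \<open>Characteristic map of an n-simplex s, applied to a point t of the closed standard
  simplex: pass to the face spanned by the vertices with positive coordinate.\<close>
definition char_pt :: "('s \<Rightarrow> nat \<Rightarrow> 's) \<Rightarrow> nat \<Rightarrow> 's \<Rightarrow> (nat \<Rightarrow> real) \<Rightarrow> 's \<times> (nat \<Rightarrow> real)" where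
  "char_pt fc n s t =
     (let I = {i. i \<le> n \<and> 0 < t i} in
       (foldl fc s (rev (sorted_list_of_set ({..n} - I))),
        \<lambda>k. if k < card I then t (sorted_list_of_set I ! k) else 0))"

definition rpoints :: "'s set \<Rightarrow> ('s \<Rightarrow> nat) \<Rightarrow> ('s \<times> (nat \<Rightarrow> real)) set" where
  "rpoints S dm = {(s, t). s \<in> S \<and> t \<in> ostdsimplex (dm s)}"

definition realization :: "'s set \<Rightarrow> ('s \<Rightarrow> nat) \<Rightarrow> ('s \<Rightarrow> nat \<Rightarrow> 's) \<Rightarrow> ('s \<times> (nat \<Rightarrow> real)) topology" where
  "realization S dm fc = topology (\<lambda>U. U \<subseteq> rpoints S dm \<and>
     (\<forall>s\<in>S. openin (subtopology (powertop_real UNIV) (stdsimplex (dm s)))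
                     {t \<in> stdsimplex (dm s). char_pt fc (dm s) s t \<in> U}))"

definition del_nth :: "nat \<Rightarrow> 'a list \<Rightarrow> 'a list" where
  "del_nth i xs = take i xs @ drop (Suc i) xs"

definition nerve_simplices :: "('o, 'm, 'z) groupoid_scheme \<Rightarrow> 'm set \<Rightarrow> ('o list \<times> (nat \<times> nat \<Rightarrow> 'm)) set" where
  "nerve_simplices G H = {(xs, f). xs \<noteq> [] \<and> set xs \<subseteq> gobj G \<and>
     (\<forall>i j. i < j \<and> j < length xs \<longrightarrow> f (i, j) \<in> H \<and> gsrc G (f (i, j)) = xs ! i \<and> gtgt G (f (i, j)) = xs ! j) \<and>
     (\<forall>i j k. i < j \<and> j < k \<and> k < length xs \<longrightarrow> gcomp G (f (j, k)) (f (i, j)) = f (i, k)) \<and>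
     (\<forall>i j. \<not> (i < j \<and> j < length xs) \<longrightarrow> f (i, j) = undefined)}"

definition nerve_dim :: "'o list \<times> (nat \<times> nat \<Rightarrow> 'm) \<Rightarrow> nat" where
  "nerve_dim s = length (fst s) - 1"

definition nerve_face :: "'o list \<times> (nat \<times> nat \<Rightarrow> 'm) \<Rightarrow> nat \<Rightarrow> 'o list \<times> (nat \<times> nat \<Rightarrow> 'm)" where
  "nerve_face s i =
     (let (xs, f) = s; sk = (\<lambda>a. if a < i then a else Suc a) in
       (del_nth i xs, \<lambda>(a, b). if a < b \<and> b < length xs - 1 then f (sk a, sk b) else undefined))"

definition Nerve :: "('o, 'm, 'z) groupoid_scheme \<Rightarrow> 'm set \<Rightarrow> (('o list \<times> (nat \<times> nat \<Rightarrow> 'm)) \<times> (nat \<Rightarrow> real)) topology" where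
  "Nerve G H = realization (nerve_simplices G H) nerve_dim nerve_face"

definition P_simplices :: "('o, 'm, 'z) groupoid_scheme \<Rightarrow> 'm set \<Rightarrow> 'o \<Rightarrow> 'm list set" where
  "P_simplices G H X = {ps. ps \<noteq> [] \<and> (\<forall>f\<in>set ps. f \<in> gmor G \<and> gsrc G f = X) \<and>
     (\<forall>i j. i < j \<and> j < length ps \<longrightarrow> gcomp G (ps ! j) (ginv G (ps ! i)) \<in> H)}"

definition PComplex :: "('o, 'm, 'z) groupoid_scheme \<Rightarrow> 'm set \<Rightarrow> 'o \<Rightarrow> ('m list \<times> (nat \<Rightarrow> real)) topology" where
  "PComplex G H X = realization (P_simplices G H X) (\<lambda>ps. length ps - 1) (\<lambda>ps i. del_nth i ps)"

definition P_proj_simplex :: "('o, 'm, 'z) groupoid_scheme \<Rightarrow> 'm list \<Rightarrow> 'o list \<times> (nat \<times> nat \<Rightarrow> 'm)" where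
  "P_proj_simplex G ps = (map (gtgt G) ps,
     \<lambda>(i, j). if i < j \<and> j < length ps then gcomp G (ps ! j) (ginv G (ps ! i)) else undefined)"

definition P_proj :: "('o, 'm, 'z) groupoid_scheme \<Rightarrow> 'm list \<times> (nat \<Rightarrow> real) \<Rightarrow> ('o list \<times> (nat \<times> nat \<Rightarrow> 'm)) \<times> (nat \<Rightarrow> real)" where
  "P_proj G p = (P_proj_simplex G (fst p), snd p)"

text \<open>Covering map in the sense of Hatcher (surjectivity not required).\<close>
definition covering_map :: "'a topology \<Rightarrow> 'b topology \<Rightarrow> ('a \<Rightarrow> 'b) \<Rightarrow> bool" where
  "covering_map E B p \<longleftrightarrow> continuous_map E B p \<and>
     (\<forall>b\<in>topspace B. \<exists>U. openin B U \<and> b \<in> U \<and>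
        (\<exists>\<V>. \<Union>\<V> = {e \<in> topspace E. p e \<in> U} \<and> pairwise disjnt \<V> \<and>
              (\<forall>V\<in>\<V>. openin E V \<and> homeomorphic_map (subtopology E V) (subtopology B U) p)))"

definition homotopic_paths_in :: "'a topology \<Rightarrow> (real \<Rightarrow> 'a) \<Rightarrow> (real \<Rightarrow> 'a) \<Rightarrow> bool" where
  "homotopic_paths_in T p q \<longleftrightarrow> pathin T p \<and> pathin T q \<and>
     homotopic_with (\<lambda>r. r 0 = p 0 \<and> r 1 = p 1) (top_of_set {0..1}) T p q"

definition simply_connected_space :: "'a topology \<Rightarrow> bool" where
  "simply_connected_space T \<longleftrightarrow> path_connected_space T \<and>
     (\<forall>p. pathin T p \<and> p 1 = p 0 \<longrightarrow> homotopic_paths_in T p (\<lambda>_. p 0))"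

definition pjoin :: "(real \<Rightarrow> 'a) \<Rightarrow> (real \<Rightarrow> 'a) \<Rightarrow> real \<Rightarrow> 'a" where
  "pjoin p q s = (if s \<le> 1/2 then p (2 * s) else q (2 * s - 1))"

definition pclass :: "'a topology \<Rightarrow> (real \<Rightarrow> 'a) \<Rightarrow> (real \<Rightarrow> 'a) set" where
  "pclass T p = {q. homotopic_paths_in T p q}"

definition fhom :: "'a topology \<Rightarrow> 'a \<Rightarrow> 'a \<Rightarrow> (real \<Rightarrow> 'a) set set" where
  "fhom T a b = {pclass T p | p. pathin T p \<and> p 0 = a \<and> p 1 = b}"

definition nvertex :: "'o \<Rightarrow> ('o list \<times> (nat \<times> nat \<Rightarrow> 'm)) \<times> (nat \<Rightarrow> real)" where
  "nvertex x = (([x], \<lambda>_. undefined), \<lambda>i. if i = 0 then 1 else 0)"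

definition nedge :: "('o, 'm, 'z) groupoid_scheme \<Rightarrow> 'm \<Rightarrow> 'o list \<times> (nat \<times> nat \<Rightarrow> 'm)" where
  "nedge G f = ([gsrc G f, gtgt G f], \<lambda>(i, j). if i = 0 \<and> j = 1 then f else undefined)"

definition edge_path :: "('o, 'm, 'z) groupoid_scheme \<Rightarrow> bool \<times> 'm \<Rightarrow> real \<Rightarrow> ('o list \<times> (nat \<times> nat \<Rightarrow> 'm)) \<times> (nat \<Rightarrow> real)" where
  "edge_path G e s = (let u = (if fst e then s else 1 - s) in
     char_pt nerve_face 1 (nedge G (snd e)) (\<lambda>i. if i = 0 then 1 - u else if i = 1 then u else 0))"

fun erealize :: "('o, 'm, 'z) groupoid_scheme \<Rightarrow> 'o \<Rightarrow> (bool \<times> 'm) list \<Rightarrow> real \<Rightarrow> ('o list \<times> (nat \<times> nat \<Rightarrow> 'm)) \<times> (nat \<Rightarrow> real)" where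
  "erealize G x [] = (\<lambda>_. nvertex x)"
| "erealize G x (e # es) = pjoin (edge_path G e) (erealize G (gtgt G (edge_mor G e)) es)"

definition omega :: "('o, 'm, 'z) groupoid_scheme \<Rightarrow> 'm set \<Rightarrow> 'o \<Rightarrow> 'o \<Rightarrow> (real \<Rightarrow> ('o list \<times> (nat \<times> nat \<Rightarrow> 'm)) \<times> (nat \<Rightarrow> real)) set \<Rightarrow> 'm" where
  "omega G H x y c = (THE f. \<exists>es. epath G H x es y \<and> erealize G x es \<in> c \<and> ecomp G x es = f)"

definition homotopically_uniquely_generates :: "('o, 'm, 'z) groupoid_scheme \<Rightarrow> 'm set \<Rightarrow> bool" where
  "homotopically_uniquely_generates G H \<longleftrightarrow> generates G H \<and>
     (\<forall>x y es1 es2. epath G H x es1 y \<and> epath G H x es2 y \<and> ecomp G x es1 = ecomp G x es2 \<longrightarrow>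
        homotopic_paths_in (Nerve G H) (erealize G x es1) (erealize G x es2))"

end

(* A point of the nerve whose open cell is s has as neighbourhood its open star with respect to the
   barycentric subdivision: the points of simplices s' whose largest coordinates span a face equal
   to s. The vertices carrying the largest coordinates are unique, and a simplex of the nerve lifts
   uniquely once one of its vertices is lifted (right translation by a morphism out of X), so this
   star is evenly covered by the stars of the lifts of s.

   The lift of an edge path that starts at the vertex a ends at the composite of the path with a.
   If the covering space is simply connected, a path of the nerve from x to y is therefore
   determined up to homotopy by the end b of its lift from a, and it is homotopic to exactly those
   edge paths whose composite is b a^{-1}. No cellular approximation is needed. *)

theory Submission
  imports Defs
begin

section \<open>Lifting through covering maps\<close>

text \<open>Ordinary open stars would not be evenly covered. An endomorphism \<open>f\<close> of
  \<open>x\<close> in \<open>H\<close> that is not an identity gives a loop in the nerve, and its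
  lift from \<open>a\<close> is an edge from \<open>a\<close> to \<open>f a\<close>: the star of
  \<open>x\<close> contains the whole loop, and the stars of \<open>a\<close> and \<open>f a\<close>
  share the lifted open edge. Strictly largest coordinates cut the edge at its midpoint. A simplex
  can still meet the star of \<open>s\<close> along several faces, but at a given point at most one
  face of each dimension is dominant.

  The paths in a class are arbitrary continuous maps, so they are lifted by general covering theory,
  built here for squares. Combinatorics enters only through the fibre over a vertex
  \<open>y\<close>, which consists of the morphisms from \<open>X\<close> to \<open>y\<close>, and
  through the lifts of single edges. Since \<open>omega\<close> equals \<open>b a^{-1}\<close> for
  any start \<open>a\<close>, the end of one lift can serve as the start of the next, which gives
  compatibility with composition.\<close>

lemma covering_mapD:
  assumes "covering_map E B p"
  shows covering_map_continuous: "continuous_map E B p"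
    and covering_map_evenly_covered: "\<And>b. b \<in> topspace B \<Longrightarrow> \<exists>U. openin B U \<and> b \<in> U \<and>
        (\<exists>\<V>. \<Union>\<V> = {e \<in> topspace E. p e \<in> U} \<and> pairwise disjnt \<V> \<and>
              (\<forall>V\<in>\<V>. openin E V \<and> homeomorphic_map (subtopology E V) (subtopology B U) p))"
  using assms unfolding covering_map_def by auto

text \<open>The set where \<open>f\<close> and \<open>g\<close> agree and the set where they differ
  are both open: near each point the two maps run in sheets over a common evenly covered set, and
  these sheets either coincide, with \<open>p\<close> injective on them, or are disjoint.
  Connectedness and the point \<open>a\<close> exclude the second set.\<close>

lemma covering_map_lift_unique:
  assumes cov: "covering_map E B p" and X: "connected_space X"
    and f: "continuous_map X E f" and g: "continuous_map X E g"
    and pfg: "\<And>x. x \<in> topspace X \<Longrightarrow> p (f x) = p (g x)"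
    and a: "a \<in> topspace X" "f a = g a" and x: "x \<in> topspace X"
  shows "f x = g x"
proof -
  let ?A = "{x \<in> topspace X. f x = g x}" and ?D = "{x \<in> topspace X. f x \<noteq> g x}"
  have sheets: "\<exists>V V'. openin E V \<and> openin E V' \<and> f y \<in> V \<and> g y \<in> V' \<and>
      (V = V' \<and> inj_on p V \<or> V \<inter> V' = {})" if y: "y \<in> topspace X" for y
  proof -
    have fy: "f y \<in> topspace E" "g y \<in> topspace E"
      using f g y by (auto simp: continuous_map_def)
    then have "p (f y) \<in> topspace B"
      using covering_map_continuous[OF cov] by (auto simp: continuous_map_def)
    then obtain U \<V> where U: "p (f y) \<in> U" and \<V>: "\<Union>\<V> = {e \<in> topspace E. p e \<in> U}"
      "pairwise disjnt \<V>"
      "\<And>V. V \<in> \<V> \<Longrightarrow> openin E V \<and> homeomorphic_map (subtopology E V) (subtopology B U) p"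
      using covering_map_evenly_covered[OF cov] by meson
    have "f y \<in> \<Union>\<V>" "g y \<in> \<Union>\<V>"
      using \<V>(1) U fy pfg[OF y] by auto
    then obtain V V' where V: "V \<in> \<V>" "f y \<in> V" "V' \<in> \<V>" "g y \<in> V'"
      by blast
    have "inj_on p V"
      using \<V>(3)[OF V(1)] openin_subset[of E V]
      by (auto simp: homeomorphic_eq_everything_map Int_absorb1)
    moreover have "V = V' \<or> V \<inter> V' = {}"
      using \<V>(2) V by (auto simp: pairwise_def disjnt_def)
    ultimately show ?thesis
      using V \<V>(3) by blast
  qed
  have "openin X ?A"
  proof (subst openin_subopen, intro ballI)
    fix y assume y: "y \<in> ?A"
    obtain V V' where V: "openin E V" "openin E V'" "f y \<in> V" "g y \<in> V'"
      "V = V' \<and> inj_on p V \<or> V \<inter> V' = {}"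
      using sheets[of y] y by blast
    let ?T = "{x \<in> topspace X. f x \<in> V} \<inter> {x \<in> topspace X. g x \<in> V}"
    have inj: "V = V'" "inj_on p V"
      using V y by auto
    have "openin X ?T"
      using openin_continuous_map_preimage[OF f] openin_continuous_map_preimage[OF g] V by blast
    moreover have "y \<in> ?T" using V y by auto
    moreover have "?T \<subseteq> ?A"
      using inj pfg by (auto dest: inj_onD)
    ultimately show "\<exists>T. openin X T \<and> y \<in> T \<and> T \<subseteq> ?A" by blast
  qed
  moreover have "openin X ?D"
  proof (subst openin_subopen, intro ballI)
    fix y assume y: "y \<in> ?D"
    obtain V V' where V: "openin E V" "openin E V'" "f y \<in> V" "g y \<in> V'"
      "V = V' \<and> inj_on p V \<or> V \<inter> V' = {}"
      using sheets[of y] y by blast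
    let ?T = "{x \<in> topspace X. f x \<in> V} \<inter> {x \<in> topspace X. g x \<in> V'}"
    have disj: "V \<inter> V' = {}"
      using V y pfg[of y] by (auto dest: inj_onD)
    have "openin X ?T"
      using openin_continuous_map_preimage[OF f] openin_continuous_map_preimage[OF g] V by blast
    moreover have "y \<in> ?T" using V y by auto
    moreover have "?T \<subseteq> ?D"
      using disj by auto
    ultimately show "\<exists>T. openin X T \<and> y \<in> T \<and> T \<subseteq> ?D" by blast
  qed
  moreover have "?A \<union> ?D = topspace X" "?A \<inter> ?D = {}" "?A \<noteq> {}"
    using a by auto
  ultimately have "?D = {}"
    using X unfolding connected_space_eq by metis
  then show ?thesis using x by auto
qed

section \<open>Lifting maps on rectangles by subdivision\<close>

text \<open>The value of the lift may be prescribed at any point of \<open>R\<close>, not at a fixed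
  base point; this lets a lift on one piece be continued into an adjacent piece from wherever they
  meet.\<close>

definition liftable :: "'e topology \<Rightarrow> ('e \<Rightarrow> 'b) \<Rightarrow> (real \<times> real \<Rightarrow> 'b) \<Rightarrow> (real \<times> real) set \<Rightarrow> bool" where
  "liftable E p h R \<longleftrightarrow> (\<forall>x\<in>R. \<forall>e\<in>topspace E. p e = h x \<longrightarrow>
     (\<exists>g. continuous_map (top_of_set R) E g \<and> (\<forall>y\<in>R. p (g y) = h y) \<and> g x = e))"

text \<open>The lift on \<open>S\<close> is started at \<open>y\<close> with the value that the lift
  on \<open>R\<close> has there. On the connected intersection uniqueness makes the two agree, so
  they paste along the closed pieces.\<close>

lemma liftable_union_aux:
  assumes cov: "covering_map E B p"
    and R: "liftable E p h R" and S: "liftable E p h S"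
    and cl: "closed R" "closed S" and con: "connected (R \<inter> S)" and y: "y \<in> R \<inter> S"
    and x: "x \<in> R" and e: "e \<in> topspace E" "p e = h x"
  shows "\<exists>g. continuous_map (top_of_set (R \<union> S)) E g \<and> (\<forall>y\<in>R \<union> S. p (g y) = h y) \<and> g x = e"
proof -
  obtain f where f: "continuous_map (top_of_set R) E f" "\<And>z. z \<in> R \<Longrightarrow> p (f z) = h z" "f x = e"
    using R x e unfolding liftable_def by meson
  have "f y \<in> topspace E"
    using f(1) y by (auto simp: continuous_map_def)
  then obtain g where g: "continuous_map (top_of_set S) E g" "\<And>z. z \<in> S \<Longrightarrow> p (g z) = h z" "g y = f y"
    using S y f(2)[of y] unfolding liftable_def by (metis IntD1 IntD2)
  have fg: "f z = g z" if "z \<in> R \<inter> S" for z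
  proof (rule covering_map_lift_unique[OF cov, where f = f and g = g and a = y])
    show "connected_space (top_of_set (R \<inter> S))"
      using con connectedin_def[of euclidean "R \<inter> S"] by simp
    show "continuous_map (top_of_set (R \<inter> S)) E f" "continuous_map (top_of_set (R \<inter> S)) E g"
      using continuous_map_from_subtopology_mono[OF f(1)] continuous_map_from_subtopology_mono[OF g(1)]
      by auto
  qed (use f(2) g(2,3) y that in auto)
  define k where "k z = (if z \<in> R then f z else g z)" for z
  have "continuous_map (top_of_set (R \<union> S)) E k"
  proof (rule pasting_lemma_closed)
    show "finite {R, S}" by simp
    show "closedin (top_of_set (R \<union> S)) T" if "T \<in> {R, S}" for T
      using that cl by (auto intro: closed_subset)
    show "continuous_map (subtopology (top_of_set (R \<union> S)) T) E (if T = R then f else g)"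
      if "T \<in> {R, S}" for T
      using that f(1) g(1) by (auto simp: subtopology_subtopology Int_absorb1)
    show "(if T = R then f else g) z = (if T' = R then f else g) z"
      if "T \<in> {R, S}" "T' \<in> {R, S}" "z \<in> topspace (top_of_set (R \<union> S)) \<inter> T \<inter> T'" for T T' z
    proof -
      have "z \<in> T" "z \<in> T'" "T = R \<or> T = S" "T' = R \<or> T' = S" using that by blast+
      then show ?thesis using fg[of z] by (metis IntI)
    qed
    show "\<exists>T. T \<in> {R, S} \<and> z \<in> T \<and> k z = (if T = R then f else g) z"
      if "z \<in> topspace (top_of_set (R \<union> S))" for z
      using that unfolding k_def by auto
  qed
  then show ?thesis
    using f g x by (intro exI[of _ k]) (auto simp: k_def)
qed

lemma liftable_union:
  assumes "covering_map E B p" "liftable E p h R" "liftable E p h S"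
    and "closed R" "closed S" "connected (R \<inter> S)" "R \<inter> S \<noteq> {}"
  shows "liftable E p h (R \<union> S)"
proof -
  obtain y where y: "y \<in> R \<inter> S" using assms by blast
  have "liftable E p h S \<Longrightarrow> x \<in> R \<union> S \<Longrightarrow> e \<in> topspace E \<Longrightarrow> p e = h x \<Longrightarrow>
    \<exists>g. continuous_map (top_of_set (R \<union> S)) E g \<and> (\<forall>y\<in>R \<union> S. p (g y) = h y) \<and> g x = e" for x e
    using liftable_union_aux[OF assms(1,2,3,4,5,6) y, of x e]
      liftable_union_aux[OF assms(1,3,2,5,4), of y x e] assms(6) y
    by (auto simp: Un_commute Int_commute)
  then show ?thesis
    using assms(3) unfolding liftable_def[of _ _ _ "R \<union> S"] by blast
qed

lemma liftable_evenly_covered: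
  assumes h: "continuous_map (top_of_set R) B h" and U: "h ` R \<subseteq> U" "openin B U"
    and \<V>: "\<Union>\<V> = {e \<in> topspace E. p e \<in> U}"
      "\<And>V. V \<in> \<V> \<Longrightarrow> openin E V \<and> homeomorphic_map (subtopology E V) (subtopology B U) p"
  shows "liftable E p h R"
  unfolding liftable_def
proof (intro ballI impI)
  fix x e assume x: "x \<in> R" and e: "e \<in> topspace E" "p e = h x"
  then have "e \<in> \<Union>\<V>" using \<V>(1) U by auto
  then obtain V where V: "V \<in> \<V>" "e \<in> V" by blast
  obtain q where q: "homeomorphic_maps (subtopology E V) (subtopology B U) p q"
    using \<V>(2)[OF V(1)] unfolding homeomorphic_map_maps by blast
  have VE: "V \<subseteq> topspace E" using \<V>(2)[OF V(1)] openin_subset by blast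
  have UB: "U \<subseteq> topspace B" using U openin_subset by blast
  show "\<exists>g. continuous_map (top_of_set R) E g \<and> (\<forall>y\<in>R. p (g y) = h y) \<and> g x = e"
  proof (intro exI[of _ "q \<circ> h"] conjI ballI)
    have "continuous_map (top_of_set R) (subtopology B U) h"
      using h U by (auto simp: continuous_map_in_subtopology)
    moreover have "continuous_map (subtopology B U) E q"
      using q by (auto simp: homeomorphic_maps_def continuous_map_in_subtopology)
    ultimately show "continuous_map (top_of_set R) E (q \<circ> h)"
      by (rule continuous_map_compose)
    show "p ((q \<circ> h) y) = h y" if "y \<in> R" for y
      using q that U UB by (auto simp: homeomorphic_maps_def)
    show "(q \<circ> h) x = e"
      using q V VE e by (auto simp: homeomorphic_maps_def simp flip: e(2))
  qed
qed

lemma liftable_locally: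
  assumes cov: "covering_map E B p" and h: "continuous_map euclidean B h"
  shows "\<exists>d>0. \<forall>R. (\<forall>y\<in>R. dist y x < d) \<longrightarrow> liftable E p h R"
proof -
  have "h x \<in> topspace B" using h by (auto simp: continuous_map_def)
  then obtain U \<V> where U: "openin B U" "h x \<in> U" and \<V>: "\<Union>\<V> = {e \<in> topspace E. p e \<in> U}"
      "\<And>V. V \<in> \<V> \<Longrightarrow> openin E V \<and> homeomorphic_map (subtopology E V) (subtopology B U) p"
    using covering_map_evenly_covered[OF cov] by meson
  have "open {y. h y \<in> U}"
    using openin_continuous_map_preimage[OF h U(1)] by simp
  then obtain d where d: "d > 0" "\<And>y. dist y x < d \<Longrightarrow> h y \<in> U"
    using U(2) unfolding open_dist by blast
  have "liftable E p h R" if R: "\<forall>y\<in>R. dist y x < d" for R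
    by (rule liftable_evenly_covered[OF _ _ U(1) \<V>])
      (use R d continuous_map_from_subtopology[OF h] in auto)
  then show ?thesis using d by blast
qed

text \<open>Compactness is used through bisection (\<open>Bolzano\<close>) instead of a Lebesgue
  number: first in the second coordinate, for thin strips, then in the first. Neighbouring
  rectangles meet in a segment, which is connected.\<close>

lemma liftable_rectangle:
  assumes cov: "covering_map E B p" and h: "continuous_map euclidean B h"
    and le: "a \<le> b" "c \<le> d"
  shows "liftable E p h ({a..b} \<times> {c..d})"
proof -
  have split1: "liftable E p h ({a..c} \<times> {u..v})"
    if "liftable E p h ({a..b} \<times> {u..v})" "liftable E p h ({b..c} \<times> {u..v})" "a \<le> b" "b \<le> c" "u \<le> v"
    for a b c u v
  proof -
    have "({a..b} \<times> {u..v}) \<union> ({b..c} \<times> {u..v}) = {a..c} \<times> {u..v}" 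
      "({a..b} \<times> {u..v}) \<inter> ({b..c} \<times> {u..v}) = {b} \<times> {u..v}" using that by auto
    then show ?thesis
      using liftable_union[OF cov that(1,2)] that(5)
      by (auto simp: closed_Times connected_Times)
  qed
  have split2: "liftable E p h ({u..v} \<times> {a..c})"
    if "liftable E p h ({u..v} \<times> {a..b})" "liftable E p h ({u..v} \<times> {b..c})" "a \<le> b" "b \<le> c" "u \<le> v"
    for a b c u v
  proof -
    have "({u..v} \<times> {a..b}) \<union> ({u..v} \<times> {b..c}) = {u..v} \<times> {a..c}" 
      "({u..v} \<times> {a..b}) \<inter> ({u..v} \<times> {b..c}) = {u..v} \<times> {b}" using that by auto
    then show ?thesis
      using liftable_union[OF cov that(1,2)] that(5)
      by (auto simp: closed_Times connected_Times)
  qed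
  \<comment> \<open>The width of the strip is quantified inside the predicate, so that it may shrink
    during the bisection: two stacked strips take the smaller width.\<close>
  have strip: "\<exists>e>0. \<forall>u v. u \<le> x \<and> x \<le> v \<and> v - u < e \<longrightarrow> liftable E p h ({u..v} \<times> {c..d})" for x
    using le(2)
  proof (induction c d rule: Bolzano)
    case (trans c y d)
    then obtain e e' where e: "e > 0" "e' > 0" 
      "\<And>u v. u \<le> x \<and> x \<le> v \<and> v - u < e \<Longrightarrow> liftable E p h ({u..v} \<times> {c..y})"
      "\<And>u v. u \<le> x \<and> x \<le> v \<and> v - u < e' \<Longrightarrow> liftable E p h ({u..v} \<times> {y..d})"
      by blast
    show ?case
      by (intro exI[of _ "min e e'"] conjI allI impI split2[of _ _ c y d]) (use e trans in auto)
  next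
    case (local y)
    obtain e where e: "e > 0" "\<And>R. (\<forall>z\<in>R. dist z (x, y) < e) \<Longrightarrow> liftable E p h R"
      using liftable_locally[OF cov h, of "(x, y)"] by blast
    \<comment> \<open>Both sides are shorter than \<open>e/2\<close>, and the distance is at most
      the sum of the coordinate differences.\<close>
    have small: "dist z (x, y) < e"
      if "c \<le> y" "y \<le> d" "d - c < e/2" "u \<le> x" "x \<le> v" "v - u < e/2" "z \<in> {u..v} \<times> {c..d}" for c d u v z
    proof -
      obtain z1 z2 where z: "z = (z1, z2)" "z1 \<in> {u..v}" "z2 \<in> {c..d}"
        using \<open>z \<in> _\<close> by auto
      have "dist z (x, y) \<le> \<bar>z1 - x\<bar> + \<bar>z2 - y\<bar>"
        using sqrt_sum_squares_le_sum_abs[of "z1 - x" "z2 - y"] by (simp add: z dist_Pair_Pair dist_real_def)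
      also have "\<dots> < e/2 + e/2"
        using that z by (intro add_strict_mono) (auto simp: abs_if)
      finally show ?thesis by simp
    qed
    show ?case
    proof (intro exI[of _ "e/2"] conjI allI impI)
      fix c d u v assume "c \<le> y \<and> y \<le> d \<and> d - c < e/2" "u \<le> x \<and> x \<le> v \<and> v - u < e/2"
      then show "liftable E p h ({u..v} \<times> {c..d})"
        by (intro e(2) ballI, rule_tac small) auto
    qed (use e(1) in simp_all)
  qed
  show ?thesis
    using le(1)
  proof (induction a b rule: Bolzano)
    case (trans a y b)
    then show ?case using split1 le(2) by blast
  qed (use strip in blast)
qed

lemma covering_map_lift_square:
  fixes h :: "real \<times> real \<Rightarrow> 'b"
  assumes cov: "covering_map E B p"
    and h: "continuous_map (prod_topology (top_of_set {0..1}) (top_of_set {0..1})) B h"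
    and e: "e \<in> topspace E" "p e = h (0, 0)"
  shows "\<exists>g. continuous_map (prod_topology (top_of_set {0..1}) (top_of_set {0..1})) E g \<and>
    (\<forall>s\<in>{0..1}. \<forall>t\<in>{0..1}. p (g (s, t)) = h (s, t)) \<and> g (0, 0) = e"
proof -
  \<comment> \<open>\<open>cl\<close> retracts the line onto the unit interval and so extends
    \<open>h\<close> to the whole plane, where the neighbourhoods of \<open>liftable_locally\<close>
    live.\<close>
  define cl :: "real \<Rightarrow> real" where "cl x = max 0 (min 1 x)" for x
  have sq: "prod_topology (top_of_set {0..1}) (top_of_set {0..1}) = top_of_set ({0..1} \<times> {0..1::real})"
    by (simp add: subtopology_Times flip: euclidean_product_topology)
  have "continuous_map euclidean (top_of_set ({0..1} \<times> {0..1})) (\<lambda>z. (cl (fst z), cl (snd z)))"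
    unfolding cl_def by (auto simp: continuous_map_in_subtopology intro!: continuous_intros)
  then have "continuous_map euclidean B (h \<circ> (\<lambda>z. (cl (fst z), cl (snd z))))"
    using h unfolding sq by (rule continuous_map_compose)
  from liftable_rectangle[OF cov this, of 0 1 0 1]
  show ?thesis
    using e unfolding sq liftable_def by (fastforce simp: cl_def)
qed

lemma covering_map_lift_path:
  assumes cov: "covering_map E B p" and q: "pathin B q" and e: "e \<in> topspace E" "p e = q 0"
  shows "\<exists>g. pathin E g \<and> (\<forall>s\<in>{0..1}. p (g s) = q s) \<and> g 0 = e"
proof -
  \<comment> \<open>The path is regarded as a map of the square that is constant in the second
    coordinate; one side of the lifted square is the lifted path.\<close>
  have "continuous_map (prod_topology (top_of_set {0..1}) (top_of_set {0..1::real})) B (q \<circ> fst)"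
    using q unfolding pathin_def by (rule continuous_map_compose[OF continuous_map_fst])
  from covering_map_lift_square[OF cov this e(1)] e(2)
  obtain g where g: "continuous_map (prod_topology (top_of_set {0..1}) (top_of_set {0..1::real})) E g"
    "\<forall>s\<in>{0..1}. \<forall>t\<in>{0..1}. p (g (s, t)) = q s" "g (0, 0) = e" unfolding o_def fst_conv by blast
  have "pathin E (g \<circ> (\<lambda>s. (s, 0)))"
    unfolding pathin_def
    by (rule continuous_map_compose[OF _ g(1)], unfold continuous_map_pairwise o_def fst_conv snd_conv)
      (auto simp: continuous_map_in_subtopology)
  then show ?thesis
    using g by (intro exI[of _ "g \<circ> (\<lambda>s. (s, 0))"]) auto
qed

lemma connected_space_unit_interval: "connected_space (top_of_set {0..1::real})"
  using connectedin_def[of euclidean "{0..1::real}"] by simp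

lemma covering_map_lift_path_unique:
  assumes "covering_map E B p" "pathin E f" "pathin E g"
    and "\<And>s. s \<in> {0..1} \<Longrightarrow> p (f s) = p (g s)" "f 0 = g 0" "s \<in> {0..1}"
  shows "f s = g s"
  using covering_map_lift_unique[OF assms(1) connected_space_unit_interval, of f g 0 s] assms
  by (auto simp: pathin_def)

text \<open>The homotopy is lifted to a map \<open>k\<close> of the square. The two sides over the
  fixed ends of the paths are lifts of constant paths, hence constant; the other two sides are
  \<open>f\<close> and \<open>g\<close> by uniqueness.\<close>

lemma covering_map_homotopic_lifts_end:
  assumes cov: "covering_map E B p" and hom: "homotopic_paths_in B q r"
    and f: "pathin E f" "\<And>s. s \<in> {0..1} \<Longrightarrow> p (f s) = q s"
    and g: "pathin E g" "\<And>s. s \<in> {0..1} \<Longrightarrow> p (g s) = r s"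
    and fg: "f 0 = g 0"
  shows "f 1 = g 1"
proof -
  let ?I = "top_of_set {0..1::real}"
  obtain h where h: "continuous_map (prod_topology ?I ?I) B h" "\<And>s. h (0, s) = q s" "\<And>s. h (1, s) = r s"
    "\<And>t. t \<in> {0..1} \<Longrightarrow> h (t, 0) = q 0 \<and> h (t, 1) = q 1"
    using hom unfolding homotopic_paths_in_def homotopic_with_def by blast
  have f0: "f 0 \<in> topspace E" using f(1) by (rule path_start_in_topspace)
  obtain k where k: "continuous_map (prod_topology ?I ?I) E k"
    "\<And>s t. s \<in> {0..1} \<Longrightarrow> t \<in> {0..1} \<Longrightarrow> p (k (s, t)) = h (s, t)" "k (0, 0) = f 0"
    using covering_map_lift_square[OF cov h(1) f0] h(2) f(2) by auto
  have row: "pathin E (\<lambda>s. k (t, s))" "pathin E (\<lambda>s. k (s, t))" if "t \<in> {0..1}" for t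
  proof -
    have "continuous_map ?I (prod_topology ?I ?I) (\<lambda>s. (t, s))" "continuous_map ?I (prod_topology ?I ?I) (\<lambda>s. (s, t))"
      unfolding continuous_map_pairwise o_def fst_conv snd_conv using that
      by (auto simp: continuous_map_in_subtopology)
    from this[THEN continuous_map_compose, OF k(1)]
    show "pathin E (\<lambda>s. k (t, s))" "pathin E (\<lambda>s. k (s, t))"
      by (simp_all add: pathin_def o_def)
  qed
  have col: "k (1, t) = k (0, t)" if "t = 0 \<or> t = 1" for t
    using covering_map_lift_path_unique[OF cov row(2)[of t], of "\<lambda>_. k (0, t)" 1]
      path_start_in_topspace[OF row(2)[of t]] that k(2) h(4)
    by auto
  have "f 1 = k (0, 1)"
    using covering_map_lift_path_unique[OF cov f(1) row(1)[of 0], of 1] f(2) k(2,3) h(2) by auto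
  moreover have "g 1 = k (1, 1)"
    using covering_map_lift_path_unique[OF cov g(1) row(1)[of 1], of 1] g(2) k(2,3) h(3) col[of 0] fg by auto
  ultimately show ?thesis using col[of 1] by simp
qed

section \<open>Homotopies of paths\<close>

lemma homotopic_paths_in_ends: "homotopic_paths_in T p q \<Longrightarrow> q 0 = p 0 \<and> q 1 = p 1"
  unfolding homotopic_paths_in_def using homotopic_with_imp_property by blast

lemma homotopic_paths_in_refl: "pathin T p \<Longrightarrow> homotopic_paths_in T p p"
  by (simp add: homotopic_paths_in_def pathin_def)

lemma homotopic_paths_in_sym: 
  assumes "homotopic_paths_in T p q" shows "homotopic_paths_in T q p"
  using assms homotopic_paths_in_ends[OF assms] homotopic_with_sym
  unfolding homotopic_paths_in_def by fastforce

lemma homotopic_paths_in_trans: 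
  assumes "homotopic_paths_in T p q" "homotopic_paths_in T q r" shows "homotopic_paths_in T p r"
  using assms homotopic_paths_in_ends[OF assms(1)] homotopic_with_trans
  unfolding homotopic_paths_in_def by fastforce

text \<open>Paths are total functions, while the projection of a lift is controlled only on the unit
  interval. This lets a path be replaced by the projection of its lift.\<close>

lemma homotopic_paths_in_eq:
  assumes "pathin T p" "\<And>s. s \<in> {0..1} \<Longrightarrow> p s = q s"
  shows "homotopic_paths_in T p q"
  using assms continuous_map_eq[of "top_of_set {0..1}" T p q]
  by (auto simp: homotopic_paths_in_def pathin_def intro!: homotopic_with_equal)

lemma homotopic_paths_in_image:
  assumes "homotopic_paths_in T p q" "continuous_map T T' f"
  shows "homotopic_paths_in T' (f \<circ> p) (f \<circ> q)"
  using assms unfolding homotopic_paths_in_def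
  by (auto intro: pathin_compose homotopic_with_compose_continuous_map_left)

lemma pclass_eq_iff:
  assumes "pathin T p"
  shows "pclass T p = pclass T q \<longleftrightarrow> homotopic_paths_in T p q"
  using homotopic_paths_in_refl[OF assms] homotopic_paths_in_sym homotopic_paths_in_trans
  unfolding pclass_def by blast

lemma pathin_pjoin:
  assumes "pathin T p" "pathin T q" "p 1 = q 0"
  shows "pathin T (pjoin p q)"
  unfolding pathin_def pjoin_def
proof (rule continuous_map_cases_le)
  have eq: "subtopology (top_of_set {0..1}) {x \<in> topspace (top_of_set {0..1}). x \<le> 1/2} = top_of_set {0..1/2::real}"
    "subtopology (top_of_set {0..1}) {x \<in> topspace (top_of_set {0..1}). 1/2 \<le> x} = top_of_set {1/2..1::real}"
    by (auto simp: subtopology_subtopology intro!: arg_cong[of _ _ top_of_set])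
  have "continuous_map (top_of_set {0..1/2}) (top_of_set {0..1}) (\<lambda>s::real. 2 * s)"
    "continuous_map (top_of_set {1/2..1}) (top_of_set {0..1}) (\<lambda>s::real. 2 * s - 1)"
    by (auto simp: continuous_map_in_subtopology intro!: continuous_intros)
  from this[THEN continuous_map_compose] show
    "continuous_map (subtopology (top_of_set {0..1}) {x \<in> topspace (top_of_set {0..1}). x \<le> 1/2}) T (\<lambda>s::real. p (2 * s))"
    "continuous_map (subtopology (top_of_set {0..1}) {x \<in> topspace (top_of_set {0..1}). 1/2 \<le> x}) T (\<lambda>s::real. q (2 * s - 1))"
    using assms(1,2) unfolding eq pathin_def o_def by blast+
  show "p (2 * s) = q (2 * s - 1)" if "s = 1/2" for s
  proof -
    have "2 * s = 1" using that by simp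
    then show ?thesis using assms(3) by (simp only:) simp
  qed
qed auto

lemma pathin_reverse: "pathin T p \<Longrightarrow> pathin T (\<lambda>s. p (1 - s))"
  unfolding pathin_def
  by (rule continuous_map_compose[where f = "\<lambda>s. 1 - s", unfolded o_def])
    (auto simp: continuous_map_in_subtopology intro!: continuous_intros)

text \<open>A null homotopy \<open>h\<close> of the loop \<open>p\<close> followed by the reverse of \<open>q\<close> is constant on three sides
  of the unit square. Sweeping the segment that ends at \<open>(0, 1/2)\<close> along these three sides
  turns \<open>p\<close> into \<open>q\<close>.\<close>

lemma simply_connected_space_homotopic_paths:
  assumes sc: "simply_connected_space T" and p: "pathin T p" and q: "pathin T q"
    and ends: "p 0 = q 0" "p 1 = q 1"
  shows "homotopic_paths_in T p q"
proof -
  let ?I = "top_of_set {0..1::real}"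
  let ?l = "pjoin p (\<lambda>s. q (1 - s))"
  have "pathin T ?l" "?l 1 = ?l 0"
    using pathin_pjoin[OF p pathin_reverse[OF q]] ends by (auto simp: pjoin_def)
  then have "homotopic_paths_in T ?l (\<lambda>_. ?l 0)"
    using sc unfolding simply_connected_space_def by blast
  then obtain h where h: "continuous_map (prod_topology ?I ?I) T h" "\<And>s. h (0, s) = ?l s" "\<And>s. h (1, s) = p 0"
    "\<And>t. t \<in> {0..1} \<Longrightarrow> h (t, 0) = p 0 \<and> h (t, 1) = p 0"
    using \<open>?l 1 = ?l 0\<close> unfolding homotopic_paths_in_def homotopic_with_def by (auto simp: pjoin_def)
  \<comment> \<open>The point \<open>(c1 r, c2 r)\<close> runs through three sides of the square,
    one third of the time each: from \<open>(0, 0)\<close> to \<open>(1, 0)\<close> to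
    \<open>(1, 1)\<close> to \<open>(0, 1)\<close>. Then \<open>m (r, s)\<close> is the point at
    time \<open>s\<close> on the segment from there to \<open>(0, 1/2)\<close>. For
    \<open>r = 0\<close> and \<open>r = 1\<close> this segment is a half of the fourth side, where
    \<open>h\<close> runs through \<open>p\<close> and \<open>q\<close>.\<close>
  define c1 c2 :: "real \<Rightarrow> real" where "c1 r = min 1 (min (3 * r) (3 - 3 * r))"
    and "c2 r = max 0 (min 1 (3 * r - 1))" for r
  define m where "m z = ((1 - snd z) * c1 (fst z), (1 - snd z) * c2 (fst z) + snd z / 2)" for z :: "real \<times> real"
  \<comment> \<open>\<open>homotopic_with\<close> prescribes its two end functions everywhere, also
    outside the unit interval, so the values on these two sides are put in by hand.\<close>
  define k where "k z = (if fst z = 0 then p (snd z) else if fst z = 1 then q (snd z) else h (m z))" for z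
  have c: "c1 r \<in> {0..1}" "c2 r \<in> {0..1}" if "r \<in> {0..1}" for r
    using that by (auto simp: c1_def c2_def)
  have side: "h (c1 r, c2 r) = p 0" if "r \<in> {0..1}" for r
  proof -
    consider "c2 r = 0" | "c1 r = 1" | "c2 r = 1"
      by (cases "r \<le> 1/3"; cases "r \<le> 2/3") (auto simp: c1_def c2_def)
    then show ?thesis using h(3,4) c[OF that] by cases auto
  qed
  have m_in: "m (r, s) \<in> {0..1} \<times> {0..1}" if "r \<in> {0..1}" "s \<in> {0..1}" for r s
  proof -
    have "(1 - s) * c1 r \<le> 1 * 1" "(1 - s) * c2 r \<le> (1 - s) * 1"
      using that c[OF that(1)] by (intro mult_mono; simp)+
    moreover have "0 \<le> (1 - s) * c1 r" "0 \<le> (1 - s) * c2 r"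
      using that c[OF that(1)] by auto
    ultimately show ?thesis using that by (auto simp: m_def)
  qed
  have km: "k z = h (m z)" if z: "z \<in> {0..1} \<times> {0..1}" for z
  proof -
    obtain r s where z': "z = (r, s)" by fastforce
    have "h (m (0, s)) = p s" 
      using z unfolding z' by (auto simp: m_def c1_def c2_def h(2) pjoin_def)
    moreover have "h (m (1, s)) = q s"
      using z ends unfolding z' by (auto simp: m_def c1_def c2_def h(2) pjoin_def field_simps)
    ultimately show ?thesis by (auto simp: k_def z')
  qed
  have sq: "prod_topology ?I ?I = top_of_set ({0..1} \<times> {0..1::real})"
    by (simp add: subtopology_Times flip: euclidean_product_topology)
  have "continuous_map (prod_topology ?I ?I) (prod_topology ?I ?I) m"
    using m_in unfolding sq m_def c1_def c2_def
    by (auto simp: continuous_map_in_subtopology intro!: continuous_intros)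
  then have "continuous_map (prod_topology ?I ?I) T (h \<circ> m)"
    using h(1) by (rule continuous_map_compose)
  then have "continuous_map (prod_topology ?I ?I) T k"
    by (rule continuous_map_eq) (use km in \<open>auto simp: sq\<close>)
  moreover have "k (r, 0) = p 0 \<and> k (r, 1) = p 1" if "r \<in> {0..1}" for r
    using km[of "(r, 0)"] km[of "(r, 1)"] side[OF that] that h(2)[of "1/2"]
    by (auto simp: m_def pjoin_def)
  ultimately have "homotopic_with (\<lambda>r. r 0 = p 0 \<and> r 1 = p 1) ?I T p q"
    unfolding homotopic_with_def by (intro exI[of _ k]) (auto simp: k_def)
  then show ?thesis using p q by (simp add: homotopic_paths_in_def)
qed

section \<open>Realizations of Delta-complexes\<close>

text \<open>This is the first component of \<open>char_pt\<close> for an arbitrary vertex set.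
  Deleting from the largest position down keeps the positions still to be deleted from
  shifting.\<close>

definition dface :: "('s \<Rightarrow> nat \<Rightarrow> 's) \<Rightarrow> nat \<Rightarrow> 's \<Rightarrow> nat set \<Rightarrow> 's" where
  "dface fc n s I = foldl fc s (rev (sorted_list_of_set ({..n} - I)))"

abbreviation nth_elem :: "nat set \<Rightarrow> nat \<Rightarrow> nat" where
  "nth_elem I \<equiv> (!) (sorted_list_of_set I)"

lemma bij_betw_nth_elem: "finite I \<Longrightarrow> bij_betw (nth_elem I) {..<card I} I"
  by (rule bij_betw_nth) auto

lemma nth_elem_less:
  assumes "finite I" "i < j" "j < card I" shows "nth_elem I i < nth_elem I j"
  using assms sorted_wrt_nth_less[of "(<)" "sorted_list_of_set I" i j] by simp

lemma nth_elem_in: "finite I \<Longrightarrow> k < card I \<Longrightarrow> nth_elem I k \<in> I"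
  using bij_betw_nth_elem[of I] by (auto simp: bij_betw_def)

lemma nth_elem_ex:
  assumes "finite I" "i \<in> I" obtains k where "k < card I" "nth_elem I k = i"
  using bij_betw_nth_elem[OF assms(1)] assms(2) unfolding bij_betw_def by (metis imageE lessThan_iff)

definition supp :: "nat \<Rightarrow> (nat \<Rightarrow> real) \<Rightarrow> nat set" where
  "supp n t = {i. i \<le> n \<and> 0 < t i}"

definition restr :: "nat set \<Rightarrow> (nat \<Rightarrow> real) \<Rightarrow> nat \<Rightarrow> real" where
  "restr I t k = (if k < card I then t (nth_elem I k) else 0)"

lemma finite_supp [simp]: "finite (supp n t)"
  by (simp add: supp_def)

lemma supp_subset: "supp n t \<subseteq> {..n}"
  by (auto simp: supp_def)

lemma supp_nonempty:
  assumes "t \<in> stdsimplex n" shows "supp n t \<noteq> {}"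
proof
  assume "supp n t = {}"
  then have "(\<Sum>i\<le>n. t i) = 0"
    using assms by (intro sum.neutral) (force simp: supp_def stdsimplex_def not_less order.antisym)
  then show False using assms by (simp add: stdsimplex_def)
qed

lemma char_pt_eq: "char_pt fc n s t = (dface fc n s (supp n t), restr (supp n t) t)"
  unfolding char_pt_def dface_def supp_def restr_def Let_def by simp

lemma restr_supp:
  assumes t: "t \<in> stdsimplex n"
  shows "restr (supp n t) t \<in> ostdsimplex (card (supp n t) - 1)"
proof -
  let ?J = "supp n t"
  have card: "card ?J > 0" using supp_nonempty[OF t] by (simp add: card_gt_0_iff)
  have "(\<Sum>k\<le>card ?J - 1. restr ?J t k) = (\<Sum>k<card ?J. t (nth_elem ?J k))"
    using card by (intro sum.cong) (auto simp: restr_def)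
  also have "\<dots> = (\<Sum>i\<in>?J. t i)"
    by (rule sum.reindex_bij_betw[OF bij_betw_nth_elem]) simp
  also have "\<dots> = (\<Sum>i\<le>n. t i)"
    by (rule sum.mono_neutral_left) (use t in \<open>auto simp: supp_def stdsimplex_def not_less intro: order.antisym\<close>)
  also have "\<dots> = 1" using t by (simp add: stdsimplex_def)
  finally show ?thesis
    using t card nth_elem_in[of ?J] by (auto simp: ostdsimplex_def stdsimplex_def restr_def supp_def)
qed

text \<open>In the interior of a simplex, \<open>dominant n I t\<close> says that \<open>t\<close> lies in the open star, with respect to
  the barycentric subdivision, of the open face spanned by \<open>I\<close>.\<close>

definition dominant :: "nat \<Rightarrow> nat set \<Rightarrow> (nat \<Rightarrow> real) \<Rightarrow> bool" where
  "dominant n I t \<longleftrightarrow> I \<subseteq> {..n} \<and> I \<noteq> {} \<and> (\<forall>i\<in>I. 0 < t i \<and> (\<forall>j\<in>{..n} - I. t j < t i))"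

lemma dominantD: "dominant n I t \<Longrightarrow> I \<subseteq> {..n}" "dominant n I t \<Longrightarrow> I \<noteq> {}"
  by (auto simp: dominant_def)

text \<open>Two dominant sets are nested: \<open>i\<close> in \<open>I\<close> but not in
  \<open>I'\<close> and \<open>j\<close> in \<open>I'\<close> but not in \<open>I\<close> would give
  both \<open>t j < t i\<close> and \<open>t i < t j\<close>. Equal size then forces
  equality.\<close>

lemma dominant_unique:
  assumes "dominant n I t" "dominant n I' t" "card I = card I'"
  shows "I = I'"
proof -
  have fin: "finite I" "finite I'"
    using assms finite_subset by (auto simp: dominant_def)
  have "I \<subseteq> I' \<or> I' \<subseteq> I"
    using assms(1,2) unfolding dominant_def by (meson DiffI less_asym subsetD subsetI)
  then show ?thesis
    using fin assms(3) card_subset_eq by metis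
qed

lemma openin_dominant:
  "openin (subtopology (powertop_real UNIV) (stdsimplex n)) {t \<in> stdsimplex n. dominant n I t}"
proof -
  let ?X = "powertop_real UNIV :: (nat \<Rightarrow> real) topology"
  have 1: "openin ?X {t. 0 < t i}" for i
    using openin_continuous_map_preimage[OF continuous_map_product_projection[of i UNIV], of "\<lambda>_. euclideanreal" "{0<..}"]
    by simp
  have 2: "openin ?X {t. t j < t i}" for i j
  proof -
    have "continuous_map ?X euclideanreal (\<lambda>t. t i - t j)"
      by (intro continuous_intros) auto
    then show ?thesis
      using openin_continuous_map_preimage[of ?X euclideanreal "\<lambda>t. t i - t j" "{0<..}"] by simp
  qed
  show ?thesis
  proof (cases "I \<subseteq> {..n} \<and> I \<noteq> {}")
    case True
    then have fin: "finite I" using finite_subset by auto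
    have "openin ?X {t. j \<in> I \<or> t j < t i}" for i j
      using 2[of j i] openin_topspace[of ?X] by (cases "j \<in> I") auto
    then have "openin ?X (\<Inter>i\<in>I. {t. 0 < t i} \<inter> (\<Inter>j\<in>{..n}. {t. j \<in> I \<or> t j < t i}))"
      using 1 fin True by (intro openin_INT2 openin_Int) auto
    moreover have "{t \<in> stdsimplex n. dominant n I t} =
      (\<Inter>i\<in>I. {t. 0 < t i} \<inter> (\<Inter>j\<in>{..n}. {t. j \<in> I \<or> t j < t i})) \<inter> stdsimplex n"
      using True by (auto simp: dominant_def)
    ultimately show ?thesis by (auto simp: openin_subtopology)
  next
    case False
    then have "{t \<in> stdsimplex n. dominant n I t} = {}" by (auto simp: dominant_def)
    then show ?thesis by (simp only: openin_empty)
  qed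
qed

text \<open>Vertices with coordinate zero lie below every vertex of a dominant set, so dominance can
  be tested in the open face that carries the point; \<open>nth_elem\<close> translates the
  numbering of that face.\<close>

lemma dominant_restr_iff:
  assumes t: "t \<in> stdsimplex n"
  shows "dominant (card (supp n t) - 1) K (restr (supp n t) t) \<longleftrightarrow>
    K \<subseteq> {..<card (supp n t)} \<and> dominant n (nth_elem (supp n t) ` K) t"
proof -
  let ?J = "supp n t"
  have card: "card ?J > 0" using supp_nonempty[OF t] by (simp add: card_gt_0_iff)
  then have atMost: "{..card ?J - 1} = {..<card ?J}" by auto
  have D: "dominant (card ?J - 1) K (restr ?J t) \<longleftrightarrow> K \<subseteq> {..<card ?J} \<and> K \<noteq> {} \<and>
      (\<forall>k\<in>K. 0 < restr ?J t k \<and> (\<forall>l\<in>{..<card ?J} - K. restr ?J t l < restr ?J t k))"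
    unfolding dominant_def atMost ..
  have inj: "inj_on (nth_elem ?J) {..<card ?J}"
    using bij_betw_nth_elem[of ?J] by (simp add: bij_betw_def)
  have J: "nth_elem ?J k \<le> n" "0 < t (nth_elem ?J k)" if "k < card ?J" for k
    using nth_elem_in[OF _ that] by (auto simp: supp_def)
  have zero: "t j = 0" if "j \<le> n" "j \<notin> ?J" for j
    using that t by (auto simp: supp_def stdsimplex_def not_less intro: order.antisym)
  show ?thesis
  proof
    assume dom: "dominant (card ?J - 1) K (restr ?J t)"
    then have K: "K \<subseteq> {..<card ?J}" unfolding D by blast
    moreover have "t j < t (nth_elem ?J k)" if k: "k \<in> K" and j: "j \<in> {..n} - nth_elem ?J ` K" for k j
    proof (cases "j \<in> ?J")
      case True
      then obtain l where l: "l < card ?J" "nth_elem ?J l = j" using nth_elem_ex finite_supp by blast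
      then have "l \<in> {..<card ?J} - K" using j by auto
      then have "restr ?J t l < restr ?J t k" using dom k unfolding D by blast
      then show ?thesis using l k K by (auto simp: restr_def)
    next
      case False
      then show ?thesis using zero J k K j by auto
    qed
    ultimately show "K \<subseteq> {..<card ?J} \<and> dominant n (nth_elem ?J ` K) t"
      using dom J unfolding D by (auto simp: dominant_def)
  next
    assume K: "K \<subseteq> {..<card ?J} \<and> dominant n (nth_elem ?J ` K) t"
    have "restr ?J t l < restr ?J t k" if "k \<in> K" "l \<in> {..<card ?J} - K" for k l
    proof -
      have "nth_elem ?J l \<in> {..n} - nth_elem ?J ` K"
        using that K J inj by (auto dest: inj_onD)
      then show ?thesis using K that by (auto simp: dominant_def restr_def)
    qed
    then show "dominant (card ?J - 1) K (restr ?J t)"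
      using K J unfolding D by (auto simp: dominant_def restr_def subset_iff)
  qed
qed

section \<open>Topology of the realization and its barycentric stars\<close>

lemma istopology_realization:
  "istopology (\<lambda>U. U \<subseteq> rpoints S dm \<and>
     (\<forall>s\<in>S. openin (subtopology (powertop_real UNIV) (stdsimplex (dm s)))
                     {t \<in> stdsimplex (dm s). char_pt fc (dm s) s t \<in> U}))"
  unfolding istopology_def
proof (intro conjI allI impI ballI)
  fix U V s
  assume U: "U \<subseteq> rpoints S dm \<and> (\<forall>s\<in>S. openin (subtopology (powertop_real UNIV) (stdsimplex (dm s)))
                     {t \<in> stdsimplex (dm s). char_pt fc (dm s) s t \<in> U})"
    and V: "V \<subseteq> rpoints S dm \<and> (\<forall>s\<in>S. openin (subtopology (powertop_real UNIV) (stdsimplex (dm s)))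
                     {t \<in> stdsimplex (dm s). char_pt fc (dm s) s t \<in> V})"
  show "U \<inter> V \<subseteq> rpoints S dm" using U by auto
  assume s: "s \<in> S"
  have "{t \<in> stdsimplex (dm s). char_pt fc (dm s) s t \<in> U \<inter> V} =
     {t \<in> stdsimplex (dm s). char_pt fc (dm s) s t \<in> U} \<inter> {t \<in> stdsimplex (dm s). char_pt fc (dm s) s t \<in> V}"
    by auto
  then show "openin (subtopology (powertop_real UNIV) (stdsimplex (dm s)))
                     {t \<in> stdsimplex (dm s). char_pt fc (dm s) s t \<in> U \<inter> V}"
    using U V s by (simp add: openin_Int)
next
  fix \<U> s
  assume U: "\<forall>U\<in>\<U>. U \<subseteq> rpoints S dm \<and> (\<forall>s\<in>S. openin (subtopology (powertop_real UNIV) (stdsimplex (dm s)))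
                     {t \<in> stdsimplex (dm s). char_pt fc (dm s) s t \<in> U})"
  then show "\<Union>\<U> \<subseteq> rpoints S dm" by blast
  assume s: "s \<in> S"
  have "{t \<in> stdsimplex (dm s). char_pt fc (dm s) s t \<in> \<Union>\<U>} =
     (\<Union>U\<in>\<U>. {t \<in> stdsimplex (dm s). char_pt fc (dm s) s t \<in> U})"
    by auto
  then show "openin (subtopology (powertop_real UNIV) (stdsimplex (dm s)))
                     {t \<in> stdsimplex (dm s). char_pt fc (dm s) s t \<in> \<Union>\<U>}"
    using U s by auto
qed

lemma openin_realization:
  "openin (realization S dm fc) U \<longleftrightarrow> U \<subseteq> rpoints S dm \<and>
     (\<forall>s\<in>S. openin (subtopology (powertop_real UNIV) (stdsimplex (dm s)))
                     {t \<in> stdsimplex (dm s). char_pt fc (dm s) s t \<in> U})"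
  unfolding realization_def topology_inverse'[OF istopology_realization] by (rule refl)

text \<open>Faces are addressed by vertex sets instead of single deletions. The simplicial
  identities then take the form \<open>dface_dface\<close>: a face of a face is a face on renumbered
  vertices.\<close>

locale delta_complex =
  fixes S :: "'s set" and dm :: "'s \<Rightarrow> nat" and fc :: "'s \<Rightarrow> nat \<Rightarrow> 's"
  assumes dface_in: "\<And>s I. s \<in> S \<Longrightarrow> I \<subseteq> {..dm s} \<Longrightarrow> I \<noteq> {} \<Longrightarrow> dface fc (dm s) s I \<in> S"
    and dm_dface: "\<And>s I. s \<in> S \<Longrightarrow> I \<subseteq> {..dm s} \<Longrightarrow> I \<noteq> {} \<Longrightarrow> dm (dface fc (dm s) s I) = card I - 1"
    and dface_dface: "\<And>s I K. s \<in> S \<Longrightarrow> I \<subseteq> {..dm s} \<Longrightarrow> K \<subseteq> {..<card I} \<Longrightarrow> K \<noteq> {} \<Longrightarrow>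
       dface fc (card I - 1) (dface fc (dm s) s I) K = dface fc (dm s) s (nth_elem I ` K)"
begin

lemma char_pt_in_rpoints:
  assumes "s \<in> S" "t \<in> stdsimplex (dm s)" shows "char_pt fc (dm s) s t \<in> rpoints S dm"
  using assms dface_in dm_dface supp_subset supp_nonempty restr_supp
  by (simp add: rpoints_def char_pt_eq)

lemma topspace_realization: "topspace (realization S dm fc) = rpoints S dm"
proof
  have "{t \<in> stdsimplex (dm s). char_pt fc (dm s) s t \<in> rpoints S dm} = stdsimplex (dm s)" if "s \<in> S" for s
    using char_pt_in_rpoints that by auto
  then have "openin (realization S dm fc) (rpoints S dm)"
    using openin_topspace[of "subtopology (powertop_real UNIV) (stdsimplex _)"]
    by (simp add: openin_realization)
  then show "rpoints S dm \<subseteq> topspace (realization S dm fc)" by (rule openin_subset)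
  show "topspace (realization S dm fc) \<subseteq> rpoints S dm"
    using openin_topspace openin_realization by blast
qed

lemma continuous_map_char_pt:
  assumes "s \<in> S"
  shows "continuous_map (subtopology (powertop_real UNIV) (stdsimplex (dm s))) (realization S dm fc) (char_pt fc (dm s) s)"
  using assms char_pt_in_rpoints by (auto simp: continuous_map_def topspace_realization openin_realization)

definition dominant_star :: "'s \<Rightarrow> ('s \<times> (nat \<Rightarrow> real)) set" where
  "dominant_star \<sigma> = {(s, t). (s, t) \<in> rpoints S dm \<and> (\<exists>I. dominant (dm s) I t \<and> dface fc (dm s) s I = \<sigma>)}"

lemma dominant_star_subset: "dominant_star \<sigma> \<subseteq> rpoints S dm"
  by (auto simp: dominant_star_def)

text \<open>A point of the realization carries the coordinates of its open cell, whereas openness is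
  tested on closed simplices. The two conditions match because a dominant set lies in the support of
  \<open>t\<close>, that is, among the vertices of the face carrying the point.\<close>

lemma char_pt_in_dominant_star_iff:
  assumes s: "s \<in> S" and t: "t \<in> stdsimplex (dm s)"
  shows "char_pt fc (dm s) s t \<in> dominant_star \<sigma> \<longleftrightarrow> (\<exists>I. dominant (dm s) I t \<and> dface fc (dm s) s I = \<sigma>)"
proof -
  let ?J = "supp (dm s) t"
  note J = supp_subset[of "dm s" t] supp_nonempty[OF t]
  have "char_pt fc (dm s) s t \<in> dominant_star \<sigma> \<longleftrightarrow>
    (\<exists>K. dominant (card ?J - 1) K (restr ?J t) \<and> dface fc (card ?J - 1) (dface fc (dm s) s ?J) K = \<sigma>)"
    using char_pt_in_rpoints[OF s t] dm_dface[OF s J] by (simp add: dominant_star_def char_pt_eq)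
  also have "\<dots> \<longleftrightarrow> (\<exists>K \<subseteq> {..<card ?J}. dominant (dm s) (nth_elem ?J ` K) t \<and> dface fc (dm s) s (nth_elem ?J ` K) = \<sigma>)"
    unfolding dominant_restr_iff[OF t] using dface_dface[OF s J(1)] dominantD(2) image_is_empty by metis
  also have "\<dots> \<longleftrightarrow> (\<exists>I \<subseteq> ?J. dominant (dm s) I t \<and> dface fc (dm s) s I = \<sigma>)"
  proof -
    have "I \<subseteq> ?J \<longleftrightarrow> (\<exists>K \<subseteq> {..<card ?J}. I = nth_elem ?J ` K)" for I
      using bij_betw_nth_elem[of ?J] subset_image_iff[of I "nth_elem ?J" "{..<card ?J}"]
      by (simp add: bij_betw_def)
    then show ?thesis by metis
  qed
  also have "\<dots> \<longleftrightarrow> (\<exists>I. dominant (dm s) I t \<and> dface fc (dm s) s I = \<sigma>)"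
  proof -
    have "I \<subseteq> ?J" if "dominant (dm s) I t" for I
      using that by (auto simp: dominant_def supp_def)
    then show ?thesis by metis
  qed
  finally show ?thesis .
qed

lemma openin_dominant_star: "openin (realization S dm fc) (dominant_star \<sigma>)"
  unfolding openin_realization
proof (intro conjI ballI)
  fix s assume s: "s \<in> S"
  \<comment> \<open>\<open>\<sigma>\<close> can be a face of \<open>s\<close> in several ways; the
    preimage of the star is the union of one open piece for each of them.\<close>
  have "{t \<in> stdsimplex (dm s). char_pt fc (dm s) s t \<in> dominant_star \<sigma>} =
    (\<Union>I\<in>{I. dface fc (dm s) s I = \<sigma>}. {t \<in> stdsimplex (dm s). dominant (dm s) I t})"
    using char_pt_in_dominant_star_iff[OF s] by auto
  then show "openin (subtopology (powertop_real UNIV) (stdsimplex (dm s)))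
      {t \<in> stdsimplex (dm s). char_pt fc (dm s) s t \<in> dominant_star \<sigma>}"
    using openin_dominant by auto
qed (rule dominant_star_subset)

lemma in_dominant_star:
  assumes "(s, t) \<in> rpoints S dm" shows "(s, t) \<in> dominant_star s"
proof -
  have "dominant (dm s) {..dm s} t" "dface fc (dm s) s {..dm s} = s"
    using assms by (auto simp: dominant_def rpoints_def ostdsimplex_def dface_def)
  then show ?thesis using assms unfolding dominant_star_def by blast
qed

lemma card_eq_if_dface_eq:
  assumes "(s, t) \<in> rpoints S dm" "dominant (dm s) I t" "dface fc (dm s) s I = \<sigma>"
  shows "card I = Suc (dm \<sigma>)"
proof -
  have "finite I" "I \<noteq> {}" using assms(2) finite_subset by (auto simp: dominant_def)
  then have "card I > 0" by (simp add: card_gt_0_iff)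
  then show ?thesis using dm_dface[of s I] assms by (auto simp: dominant_def rpoints_def)
qed

end

section \<open>A combinatorial criterion for covering maps\<close>

text \<open>\<open>lift_ex\<close> and \<open>lift_unique\<close> are the combinatorial form of
  local triviality. Existence makes \<open>Fmap\<close> open and each sheet full; uniqueness keeps
  different sheets apart and makes \<open>Fmap\<close> injective on each.\<close>

locale delta_covering =
  E: delta_complex SE dE fE + B: delta_complex SB dB fB
  for SE :: "'e set" and dE fE and SB :: "'b set" and dB fB +
  fixes F :: "'e \<Rightarrow> 'b"
  assumes F_in: "s \<in> SE \<Longrightarrow> F s \<in> SB"
    and dB_F: "s \<in> SE \<Longrightarrow> dB (F s) = dE s"
    and F_dface: "s \<in> SE \<Longrightarrow> I \<subseteq> {..dE s} \<Longrightarrow> I \<noteq> {} \<Longrightarrow> F (dface fE (dE s) s I) = dface fB (dE s) (F s) I"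
    and lift_ex: "\<tau> \<in> SB \<Longrightarrow> J \<subseteq> {..dB \<tau>} \<Longrightarrow> J \<noteq> {} \<Longrightarrow> \<sigma> \<in> SE \<Longrightarrow> F \<sigma> = dface fB (dB \<tau>) \<tau> J \<Longrightarrow>
      \<exists>s\<in>SE. F s = \<tau> \<and> dface fE (dE s) s J = \<sigma>"
    and lift_unique: "s \<in> SE \<Longrightarrow> s' \<in> SE \<Longrightarrow> F s = F s' \<Longrightarrow> J \<subseteq> {..dE s} \<Longrightarrow> J \<noteq> {} \<Longrightarrow>
      dface fE (dE s) s J = dface fE (dE s') s' J \<Longrightarrow> s = s'"
begin

abbreviation "TE \<equiv> realization SE dE fE"
abbreviation "TB \<equiv> realization SB dB fB"

definition Fmap :: "'e \<times> (nat \<Rightarrow> real) \<Rightarrow> 'b \<times> (nat \<Rightarrow> real)" where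
  "Fmap z = (F (fst z), snd z)"

lemma Fmap_rpoints: "z \<in> rpoints SE dE \<Longrightarrow> Fmap z \<in> rpoints SB dB"
  using F_in dB_F by (auto simp: rpoints_def Fmap_def)

lemma Fmap_char_pt:
  assumes "s \<in> SE" "t \<in> stdsimplex (dE s)"
  shows "Fmap (char_pt fE (dE s) s t) = char_pt fB (dE s) (F s) t"
  using F_dface[OF assms(1) supp_subset supp_nonempty[OF assms(2)]]
  by (simp add: Fmap_def char_pt_eq)

lemma continuous_map_Fmap: "continuous_map TE TB Fmap"
proof -
  have "openin TE {z \<in> rpoints SE dE. Fmap z \<in> U}" if U: "openin TB U" for U
    unfolding openin_realization
  proof (intro conjI ballI)
    fix s assume s: "s \<in> SE"
    have "{t \<in> stdsimplex (dE s). char_pt fE (dE s) s t \<in> {z \<in> rpoints SE dE. Fmap z \<in> U}} =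
      {t \<in> stdsimplex (dB (F s)). char_pt fB (dB (F s)) (F s) t \<in> U}"
      using Fmap_char_pt[OF s] E.char_pt_in_rpoints[OF s] dB_F[OF s] by auto
    then show "openin (subtopology (powertop_real UNIV) (stdsimplex (dE s)))
      {t \<in> stdsimplex (dE s). char_pt fE (dE s) s t \<in> {z \<in> rpoints SE dE. Fmap z \<in> U}}"
      using U F_in[OF s] dB_F[OF s] unfolding openin_realization by auto
  qed auto
  then show ?thesis
    using Fmap_rpoints by (auto simp: continuous_map_def E.topspace_realization B.topspace_realization)
qed

text \<open>On a simplex \<open>\<tau>\<close>, the preimage of the image of \<open>V\<close> is the
  union, over all lifts \<open>s\<close> of \<open>\<tau>\<close>, of the preimages of
  \<open>V\<close>. For the harder inclusion, the point of \<open>V\<close> provides a lift of the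
  face carrying the given point, and \<open>lift_ex\<close> extends it to all of
  \<open>\<tau>\<close>.\<close>

lemma open_map_Fmap: "open_map TE TB Fmap"
  unfolding open_map_def
proof (intro allI impI)
  fix V assume V: "openin TE V"
  then have VE: "V \<subseteq> rpoints SE dE" by (simp add: openin_realization)
  show "openin TB (Fmap ` V)"
    unfolding openin_realization
  proof (intro conjI ballI)
    show "Fmap ` V \<subseteq> rpoints SB dB" using VE Fmap_rpoints by auto
    fix \<tau> assume \<tau>: "\<tau> \<in> SB"
    have "{t \<in> stdsimplex (dB \<tau>). char_pt fB (dB \<tau>) \<tau> t \<in> Fmap ` V} =
      (\<Union>s\<in>{s \<in> SE. F s = \<tau>}. {t \<in> stdsimplex (dE s). char_pt fE (dE s) s t \<in> V})" (is "?L = ?R")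
    proof
      show "?R \<subseteq> ?L"
        using Fmap_char_pt dB_F by (auto intro!: image_eqI)
      show "?L \<subseteq> ?R"
      proof
        fix t assume "t \<in> ?L"
        then obtain z where t: "t \<in> stdsimplex (dB \<tau>)" and z: "z \<in> V" "char_pt fB (dB \<tau>) \<tau> t = Fmap z" by blast
        let ?J = "supp (dB \<tau>) t"
        have "fst z \<in> SE" using z VE by (auto simp: rpoints_def)
        moreover have "F (fst z) = dface fB (dB \<tau>) \<tau> ?J" and snd: "snd z = restr ?J t"
          using z(2) by (auto simp: char_pt_eq Fmap_def)
        ultimately obtain s where s: "s \<in> SE" "F s = \<tau>" "dface fE (dE s) s ?J = fst z"
          using lift_ex[OF \<tau> supp_subset supp_nonempty[OF t]] by blast
        then have "char_pt fE (dE s) s t = z"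
          using snd dB_F[OF s(1)] by (simp add: char_pt_eq prod_eq_iff)
        then show "t \<in> ?R" using s z t dB_F[OF s(1)] by auto
      qed
    qed
    moreover have "openin (subtopology (powertop_real UNIV) (stdsimplex (dB \<tau>)))
      {t \<in> stdsimplex (dE s). char_pt fE (dE s) s t \<in> V}" if "s \<in> SE" "F s = \<tau>" for s
      using V that dB_F[of s] unfolding openin_realization by auto
    ultimately show "openin (subtopology (powertop_real UNIV) (stdsimplex (dB \<tau>)))
      {t \<in> stdsimplex (dB \<tau>). char_pt fB (dB \<tau>) \<tau> t \<in> Fmap ` V}"
      by auto
  qed
qed

lemma Fmap_in_dominant_star_iff:
  assumes "z \<in> rpoints SE dE"
  shows "Fmap z \<in> B.dominant_star \<tau> \<longleftrightarrow> (\<exists>\<sigma>\<in>SE. F \<sigma> = \<tau> \<and> z \<in> E.dominant_star \<sigma>)"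
proof -
  obtain s t where z: "z = (s, t)" by fastforce
  then have s: "s \<in> SE" using assms by (auto simp: rpoints_def)
  have "Fmap z \<in> B.dominant_star \<tau> \<longleftrightarrow> (\<exists>I. dominant (dE s) I t \<and> dface fB (dE s) (F s) I = \<tau>)"
    using Fmap_rpoints[OF assms] dB_F[OF s] by (auto simp: z B.dominant_star_def Fmap_def)
  also have "\<dots> \<longleftrightarrow> (\<exists>I. dominant (dE s) I t \<and> F (dface fE (dE s) s I) = \<tau>)"
    using F_dface[OF s] dominantD by metis
  also have "\<dots> \<longleftrightarrow> (\<exists>\<sigma>\<in>SE. F \<sigma> = \<tau> \<and> z \<in> E.dominant_star \<sigma>)"
    using E.dface_in[OF s dominantD] assms unfolding E.dominant_star_def z by blast
  finally show ?thesis .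
qed

text \<open>Both points have the same coordinates \<open>t\<close>, and their dominant sets have the
  same size because \<open>\<sigma>\<close> and \<open>\<sigma>'\<close> have the same dimension; so
  there is only one set \<open>I\<close>. Hence \<open>\<sigma>\<close> and \<open>\<sigma>'\<close>
  are the faces on \<open>I\<close> of two lifts of one simplex. Left to right this separates the
  sheets, right to left it gives injectivity.\<close>

lemma dominant_star_sheet:
  assumes z: "z \<in> E.dominant_star \<sigma>" "z' \<in> E.dominant_star \<sigma>'"
    and eq: "Fmap z = Fmap z'" "F \<sigma> = F \<sigma>'" and \<sigma>: "\<sigma> \<in> SE" "\<sigma>' \<in> SE"
  shows "z = z' \<longleftrightarrow> \<sigma> = \<sigma>'"
proof -
  obtain s t s' where zs: "z = (s, t)" "z' = (s', t)" "F s = F s'"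
    using eq(1) by (cases z; cases z') (auto simp: Fmap_def)
  obtain I I' where I: "dominant (dE s) I t" "dface fE (dE s) s I = \<sigma>"
     "dominant (dE s') I' t" "dface fE (dE s') s' I' = \<sigma>'"
    and r: "(s, t) \<in> rpoints SE dE" "(s', t) \<in> rpoints SE dE"
    using z by (auto simp: E.dominant_star_def zs)
  have s: "s \<in> SE" "s' \<in> SE" using r by (auto simp: rpoints_def)
  have dim: "dE s = dE s'" "dE \<sigma> = dE \<sigma>'" using dB_F s \<sigma> zs(3) eq(2) by metis+
  have "I = I'"
    using dominant_unique[of "dE s" I t I'] I dim E.card_eq_if_dface_eq[OF r(1) I(1,2)]
      E.card_eq_if_dface_eq[OF r(2) I(3,4)] by simp
  then show ?thesis
    using I zs s lift_unique[OF s zs(3), of I] dim by (auto simp: dominant_def)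
qed

theorem covering_map_Fmap: "covering_map TE TB Fmap"
  unfolding covering_map_def
proof (intro conjI ballI)
  show "continuous_map TE TB Fmap" by (rule continuous_map_Fmap)
  fix b assume b: "b \<in> topspace TB"
  define \<tau> where "\<tau> = fst b"
  let ?U = "B.dominant_star \<tau>"
  let ?\<V> = "E.dominant_star ` {\<sigma> \<in> SE. F \<sigma> = \<tau>}"
  have "b \<in> ?U"
    using B.in_dominant_star[of \<tau> "snd b"] b by (simp add: \<tau>_def B.topspace_realization)
  moreover have "\<Union>?\<V> = {e \<in> topspace TE. Fmap e \<in> ?U}"
    using Fmap_in_dominant_star_iff[of _ \<tau>] E.dominant_star_subset
    unfolding E.topspace_realization by blast
  moreover have "pairwise disjnt ?\<V>"
    unfolding pairwise_def disjnt_def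
  proof (intro ballI impI)
    fix V V' assume "V \<in> ?\<V>" "V' \<in> ?\<V>" "V \<noteq> V'"
    then obtain \<sigma> \<sigma>' where "\<sigma> \<in> SE" "\<sigma>' \<in> SE" "F \<sigma> = \<tau>" "F \<sigma>' = \<tau>" "\<sigma> \<noteq> \<sigma>'"
      "V = E.dominant_star \<sigma>" "V' = E.dominant_star \<sigma>'" by auto
    then show "V \<inter> V' = {}" using dominant_star_sheet by (metis disjoint_iff)
  qed
  moreover have "openin TE (E.dominant_star \<sigma>) \<and>
      homeomorphic_map (subtopology TE (E.dominant_star \<sigma>)) (subtopology TB ?U) Fmap"
    if \<sigma>: "\<sigma> \<in> SE" "F \<sigma> = \<tau>" for \<sigma>
  proof
    let ?V = "E.dominant_star \<sigma>"
    show V: "openin TE ?V" by (rule E.openin_dominant_star)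
    have VE: "?V \<subseteq> rpoints SE dE" by (rule E.dominant_star_subset)
    have img: "Fmap ` ?V = ?U"
    proof
      show "Fmap ` ?V \<subseteq> ?U"
        using \<sigma> VE Fmap_in_dominant_star_iff by blast
      show "?U \<subseteq> Fmap ` ?V"
      proof
        fix y assume y: "y \<in> ?U"
        then obtain s t I where s: "y = (s, t)" "s \<in> SB" "t \<in> ostdsimplex (dB s)" 
          and I: "dominant (dB s) I t" "dface fB (dB s) s I = \<tau>"
          by (auto simp: B.dominant_star_def rpoints_def)
        \<comment> \<open>\<open>\<sigma>\<close> is a lift of the dominant face of
          \<open>y\<close>, and it extends to a lift of the whole simplex.\<close>
        obtain s' where s': "s' \<in> SE" "F s' = s" "dface fE (dE s') s' I = \<sigma>"
          using lift_ex[OF s(2), of I \<sigma>] I \<sigma> by (auto simp: dominant_def)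
        have "(s', t) \<in> ?V"
          using s s' I dB_F[OF s'(1)] by (auto simp: E.dominant_star_def rpoints_def)
        then show "y \<in> Fmap ` ?V" using s s' by (force simp: Fmap_def)
      qed
    qed
    have UB: "?U \<subseteq> rpoints SB dB" by (rule B.dominant_star_subset)
    show "homeomorphic_map (subtopology TE ?V) (subtopology TB ?U) Fmap"
    proof (rule bijective_open_imp_homeomorphic_map)
      show "continuous_map (subtopology TE ?V) (subtopology TB ?U) Fmap"
        using continuous_map_Fmap img
        by (auto simp: continuous_map_in_subtopology continuous_map_from_subtopology)
      show "open_map (subtopology TE ?V) (subtopology TB ?U) Fmap"
        using open_map_Fmap V img B.openin_dominant_star[of \<tau>]
        unfolding open_map_def openin_open_subtopology[OF V] openin_open_subtopology[OF B.openin_dominant_star]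
        by blast
      show "Fmap ` topspace (subtopology TE ?V) = topspace (subtopology TB ?U)"
        using img VE UB by (simp add: E.topspace_realization B.topspace_realization Int_absorb1)
      show "inj_on Fmap (topspace (subtopology TE ?V))"
        by (rule inj_onI) (metis IntD2 topspace_subtopology dominant_star_sheet \<sigma>(1))
    qed
  qed
  ultimately show "\<exists>U. openin TB U \<and> b \<in> U \<and>
        (\<exists>\<V>. \<Union>\<V> = {e \<in> topspace TE. Fmap e \<in> U} \<and> pairwise disjnt \<V> \<and>
              (\<forall>V\<in>\<V>. openin TE V \<and> homeomorphic_map (subtopology TE V) (subtopology TB U) Fmap))"
    using B.openin_dominant_star by (intro exI[of _ ?U] conjI exI[of _ ?\<V>]) auto
qed

end

section \<open>Faces of the nerve\<close>

text \<open>All positions deleted so far exceed \<open>d\<close>, so \<open>d\<close> still denotes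
  the same entry.\<close>

lemma del_nth_nths:
  assumes D: "D \<subseteq> {d<..}" and d: "d < length xs"
  shows "d < length (nths xs (- D))" "del_nth d (nths xs (- D)) = nths xs (- insert d D)"
proof -
  let ?A = "take d xs" and ?B = "drop (Suc d) xs"
  have xs: "xs = ?A @ xs ! d # ?B" using id_take_nth_drop[OF d] .
  have A: "nths ?A (- D) = ?A" "nths ?A (- insert d D) = ?A"
    using D d by (auto intro!: nths_all)
  have len: "length ?A = d" using d by simp
  have "nths xs (- D) = ?A @ xs ! d # nths ?B {j. Suc j + d \<in> - D}"
    by (subst xs, unfold nths_append nths_Cons A len) (use D in auto)
  moreover have "nths xs (- insert d D) = ?A @ nths ?B {j. Suc j + d \<in> - D}"
    by (subst xs, unfold nths_append nths_Cons A len) auto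
  ultimately show "d < length (nths xs (- D))" "del_nth d (nths xs (- D)) = nths xs (- insert d D)"
    using len by (auto simp: del_nth_def)
qed

lemma foldr_del_nth:
  "sorted_wrt (<) ds \<Longrightarrow> set ds \<subseteq> {..<length xs} \<Longrightarrow> foldr (\<lambda>i s. del_nth i s) ds xs = nths xs (- set ds)"
proof (induction ds)
  case Nil
  then show ?case by (simp add: nths_all)
next
  case (Cons d ds)
  then show ?case using del_nth_nths(2)[of "set ds" d xs] by (auto simp: subset_iff)
qed

text \<open>Faces in the nerve are computed on lists of morphisms from here on; by
  \<open>nerve_simplex_lift\<close> every simplex of the nerve comes from such a list.\<close>

lemma nerve_face_P_proj_simplex:
  assumes "i < length ps"
  shows "nerve_face (P_proj_simplex G ps) i = P_proj_simplex G (del_nth i ps)"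
proof -
  have "del_nth i ps ! a = ps ! (if a < i then a else Suc a)" if "a < length ps - 1" for a
    using assms that by (auto simp: del_nth_def nth_append min_def)
  moreover have "length (del_nth i ps) = length ps - 1" using assms by (auto simp: del_nth_def)
  moreover have "map (gtgt G) (del_nth i ps) = del_nth i (map (gtgt G) ps)"
    by (simp add: del_nth_def take_map drop_map)
  ultimately show ?thesis
    by (auto simp: nerve_face_def P_proj_simplex_def Let_def fun_eq_iff)
qed

lemma foldr_nerve_face:
  "sorted_wrt (<) ds \<Longrightarrow> set ds \<subseteq> {..<length ps} \<Longrightarrow>
    foldr (\<lambda>i s. nerve_face s i) ds (P_proj_simplex G ps) = P_proj_simplex G (nths ps (- set ds))"
proof (induction ds)
  case Nil
  then show ?case by (simp add: nths_all)
next
  case (Cons d ds)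
  then show ?case
    using del_nth_nths[of "set ds" d ps] nerve_face_P_proj_simplex[of d "nths ps (- set ds)" G]
    by (auto simp: subset_iff)
qed

lemma sorted_list_of_set_filter:
  assumes "I \<subseteq> {..<n}" shows "sorted_list_of_set I = filter (\<lambda>i. i \<in> I) [0..<n]"
proof -
  have "finite I" using assms finite_subset by blast
  moreover have "sorted_wrt (<) (filter (\<lambda>i. i \<in> I) [0..<n])"
    by (simp add: sorted_wrt_filter)
  moreover have "set (filter (\<lambda>i. i \<in> I) [0..<n]) = I" using assms by auto
  ultimately show ?thesis
    by (metis sorted_list_of_set_unique distinct_card strict_sorted_iff)
qed

lemma nths_eq_map:
  assumes "I \<subseteq> {..<length xs}" shows "nths xs I = map ((!) xs) (sorted_list_of_set I)"
proof -
  have "zip xs [0..<length xs] = map (\<lambda>i. (xs ! i, i)) [0..<length xs]"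
    by (rule nth_equalityI) auto
  then show ?thesis
    by (simp add: nths_def sorted_list_of_set_filter[OF assms] filter_map o_def)
qed

lemma sorted_list_of_set_nth_elem_image:
  assumes "finite I" "K \<subseteq> {..<card I}"
  shows "sorted_list_of_set (nth_elem I ` K) = map (nth_elem I) (sorted_list_of_set K)"
proof -
  have K: "finite K" using assms(2) finite_subset by blast
  have "sorted_wrt (\<lambda>i j. nth_elem I i < nth_elem I j) (sorted_list_of_set K)"
    by (rule sorted_wrt_mono_rel[of _ "(<)"]) (use K assms nth_elem_less[OF assms(1)] in auto)
  then have "sorted_wrt (<) (map (nth_elem I) (sorted_list_of_set K))"
    by (simp add: sorted_wrt_map)
  moreover have "set (map (nth_elem I) (sorted_list_of_set K)) = nth_elem I ` K" using K by simp
  ultimately show ?thesis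
    using K by (metis finite_imageI sorted_list_of_set_unique distinct_card strict_sorted_iff)
qed

lemma sub_face:
  assumes "ps \<noteq> []" "I \<subseteq> {..length ps - 1}"
  shows dface_del_nth: "dface (\<lambda>ps i. del_nth i ps) (length ps - 1) ps I = map ((!) ps) (sorted_list_of_set I)"
    and dface_nerve: "dface nerve_face (length ps - 1) (P_proj_simplex G ps) I = P_proj_simplex G (map ((!) ps) (sorted_list_of_set I))"
proof -
  let ?D = "{..length ps - 1} - I"
  have atMost: "{..length ps - 1} = {..<length ps}" using assms(1) by (cases ps) auto
  have D: "sorted_wrt (<) (sorted_list_of_set ?D)" "set (sorted_list_of_set ?D) \<subseteq> {..<length ps}"
    unfolding atMost by auto
  have "nths ps (- ?D) = nths ps I"
    unfolding nths_def by (rule arg_cong[of _ _ "map fst"], rule filter_cong)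
      (use assms atMost in \<open>auto dest!: set_zip_rightD\<close>)
  then have "nths ps (- set (sorted_list_of_set ?D)) = map ((!) ps) (sorted_list_of_set I)"
    using nths_eq_map[of I ps] assms(2) unfolding atMost by simp
  then show "dface (\<lambda>ps i. del_nth i ps) (length ps - 1) ps I = map ((!) ps) (sorted_list_of_set I)"
    "dface nerve_face (length ps - 1) (P_proj_simplex G ps) I = P_proj_simplex G (map ((!) ps) (sorted_list_of_set I))"
    unfolding dface_def using foldr_del_nth[OF D] foldr_nerve_face[OF D]
    by (simp_all add: foldl_conv_foldr)
qed

section \<open>Groupoids\<close>

locale generated_groupoid =
  fixes G :: "('o, 'm) groupoid" and H :: "'m set"
  assumes grp: "groupoid G" and gen: "generates G H"
begin

lemma ghomI: "f \<in> gmor G \<Longrightarrow> f \<in> ghom G (gsrc G f) (gtgt G f)"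
  by (simp add: ghom_def)

lemma ghomD: 
  assumes "f \<in> ghom G x y" 
  shows "f \<in> gmor G" "gsrc G f = x" "gtgt G f = y" "x \<in> gobj G" "y \<in> gobj G"
  using assms grp by (auto simp: ghom_def groupoid_def)

lemma comp_ghom: "f \<in> ghom G x y \<Longrightarrow> g \<in> ghom G y z \<Longrightarrow> gcomp G g f \<in> ghom G x z"
  using grp by (simp add: ghom_def groupoid_def)

lemma comp_assoc:
  "f \<in> ghom G x y \<Longrightarrow> g \<in> ghom G y z \<Longrightarrow> h \<in> ghom G z w \<Longrightarrow>
    gcomp G (gcomp G h g) f = gcomp G h (gcomp G g f)"
  using grp unfolding ghom_def groupoid_def by (metis (mono_tags, lifting) mem_Collect_eq)

lemma id_ghom: "x \<in> gobj G \<Longrightarrow> gid G x \<in> ghom G x x"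
  using grp by (simp add: ghom_def groupoid_def)

lemma comp_id: "f \<in> ghom G x y \<Longrightarrow> gcomp G f (gid G x) = f" "f \<in> ghom G x y \<Longrightarrow> gcomp G (gid G y) f = f"
  using grp by (auto simp: ghom_def groupoid_def)

lemma inv_ghom: "f \<in> ghom G x y \<Longrightarrow> ginv G f \<in> ghom G y x"
  using grp by (simp add: ghom_def groupoid_def)

lemma comp_inv: "f \<in> ghom G x y \<Longrightarrow> gcomp G (ginv G f) f = gid G x" "f \<in> ghom G x y \<Longrightarrow> gcomp G f (ginv G f) = gid G y"
  using grp by (auto simp: ghom_def groupoid_def)

lemma inv_comp_cancel:
  assumes "f \<in> ghom G x y"
  shows "g \<in> ghom G w x \<Longrightarrow> gcomp G (ginv G f) (gcomp G f g) = g"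
    and "g \<in> ghom G w y \<Longrightarrow> gcomp G f (gcomp G (ginv G f) g) = g"
    and "g \<in> ghom G y z \<Longrightarrow> gcomp G (gcomp G g f) (ginv G f) = g"
    and "g \<in> ghom G x z \<Longrightarrow> gcomp G (gcomp G g (ginv G f)) f = g"
  using comp_assoc[OF _ assms inv_ghom[OF assms]] comp_assoc[OF _ inv_ghom[OF assms] assms]
    comp_assoc[OF inv_ghom[OF assms] assms] comp_assoc[OF assms inv_ghom[OF assms]]
    comp_inv[OF assms] comp_id by simp_all

lemma inv_unique:
  assumes "f \<in> ghom G x y" "g \<in> ghom G y x" "gcomp G g f = gid G x"
  shows "ginv G f = g"
  using inv_comp_cancel(3)[OF assms(1,2)] comp_id(2)[OF inv_ghom[OF assms(1)]] assms(3) by simp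

lemma inv_comp:
  assumes "f \<in> ghom G x y" "g \<in> ghom G y z"
  shows "ginv G (gcomp G g f) = gcomp G (ginv G f) (ginv G g)"
proof (rule inv_unique)
  note i = inv_ghom[OF assms(1)] inv_ghom[OF assms(2)]
  show "gcomp G g f \<in> ghom G x z" "gcomp G (ginv G f) (ginv G g) \<in> ghom G z x"
    using comp_ghom assms i by blast+
  show "gcomp G (gcomp G (ginv G f) (ginv G g)) (gcomp G g f) = gid G x"
    using comp_assoc[OF comp_ghom[OF assms] i(2,1)] inv_comp_cancel(1)[OF assms(2,1)] comp_inv(1)[OF assms(1)]
    by simp
qed

lemma inv_inv: "f \<in> ghom G x y \<Longrightarrow> ginv G (ginv G f) = f"
  by (rule inv_unique[OF inv_ghom _ comp_inv(2)])

lemma inv_id: "x \<in> gobj G \<Longrightarrow> ginv G (gid G x) = gid G x"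
  by (rule inv_unique[OF id_ghom id_ghom comp_id(1)[OF id_ghom]])

lemma quotient_translate:
  assumes "q \<in> ghom G X x" "f \<in> ghom G x y" "g \<in> ghom G x z"
  shows "gcomp G (gcomp G g q) (ginv G (gcomp G f q)) = gcomp G g (ginv G f)"
proof -
  have "gcomp G (gcomp G g q) (gcomp G (ginv G q) (ginv G f)) = gcomp G g (gcomp G q (gcomp G (ginv G q) (ginv G f)))"
    using comp_assoc[OF comp_ghom[OF inv_ghom[OF assms(2)] inv_ghom[OF assms(1)]] assms(1,3)] by simp
  then show ?thesis
    using inv_comp[OF assms(1,2)] inv_comp_cancel(2)[OF assms(1) inv_ghom[OF assms(2)]] by simp
qed

lemma H_ghom: "f \<in> H \<Longrightarrow> f \<in> ghom G (gsrc G f) (gtgt G f)"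
  using gen ghomI by (auto simp: generates_def)

section \<open>Lifting simplices of the nerve\<close>

lemma P_simplicesD:
  assumes "ps \<in> P_simplices G H X"
  shows "ps \<noteq> []" "\<And>i. i < length ps \<Longrightarrow> ps ! i \<in> ghom G X (gtgt G (ps ! i))"
    "\<And>i j. i < j \<Longrightarrow> j < length ps \<Longrightarrow> gcomp G (ps ! j) (ginv G (ps ! i)) \<in> H"
  using assms by (auto simp: P_simplices_def ghom_def)

lemma P_simplicesI:
  assumes "ps \<noteq> []" "\<And>i. i < length ps \<Longrightarrow> \<exists>y. ps ! i \<in> ghom G X y"
    "\<And>i j. i < j \<Longrightarrow> j < length ps \<Longrightarrow> gcomp G (ps ! j) (ginv G (ps ! i)) \<in> H"
  shows "ps \<in> P_simplices G H X"
  using assms unfolding P_simplices_def by (auto simp: in_set_conv_nth ghom_def)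

text \<open>Right translation cancels in the quotients of vertices, and the projection records only
  these quotients and the targets. It turns lifts based at \<open>x\<close> into lifts based at
  \<open>X\<close>.\<close>

lemma P_simplices_translate:
  assumes ps: "ps \<in> P_simplices G H x" and q: "q \<in> ghom G X x"
  shows "map (\<lambda>f. gcomp G f q) ps \<in> P_simplices G H X"
    and "P_proj_simplex G (map (\<lambda>f. gcomp G f q) ps) = P_proj_simplex G ps"
proof -
  note D = P_simplicesD[OF ps]
  have c: "gcomp G (ps ! i) q \<in> ghom G X (gtgt G (ps ! i))" if "i < length ps" for i
    using comp_ghom[OF q D(2)[OF that]] .
  have e: "gcomp G (gcomp G (ps ! j) q) (ginv G (gcomp G (ps ! i) q)) = gcomp G (ps ! j) (ginv G (ps ! i))"
    if "i < length ps" "j < length ps" for i j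
    using quotient_translate[OF q D(2) D(2)] that by blast
  show "map (\<lambda>f. gcomp G f q) ps \<in> P_simplices G H X"
    using D(1,3) e by (intro P_simplicesI) (auto intro!: exI c)
  show "P_proj_simplex G (map (\<lambda>f. gcomp G f q) ps) = P_proj_simplex G ps"
    using c e ghomD(3)[OF c] by (auto simp: P_proj_simplex_def fun_eq_iff in_set_conv_nth)
qed

lemma P_proj_simplex_in_nerve:
  assumes ps: "ps \<in> P_simplices G H X" shows "P_proj_simplex G ps \<in> nerve_simplices G H"
proof -
  note D = P_simplicesD[OF ps]
  have q: "gcomp G (ps ! j) (ginv G (ps ! i)) \<in> ghom G (gtgt G (ps ! i)) (gtgt G (ps ! j))"
    if "i < length ps" "j < length ps" for i j
    using comp_ghom inv_ghom D(2) that by blast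
  have "gcomp G (gcomp G (ps ! k) (ginv G (ps ! j))) (gcomp G (ps ! j) (ginv G (ps ! i))) = gcomp G (ps ! k) (ginv G (ps ! i))"
    if "i < length ps" "j < length ps" "k < length ps" for i j k
    using comp_assoc[OF q[OF that(1,2)] inv_ghom[OF D(2)[OF that(2)]] D(2)[OF that(3)]]
      inv_comp_cancel(1)[OF D(2)[OF that(2)] inv_ghom[OF D(2)[OF that(1)]]] by simp
  moreover have "set (map (gtgt G) ps) \<subseteq> gobj G"
    using ghomD(5)[OF D(2)] by (auto simp: in_set_conv_nth)
  ultimately show ?thesis
    using D(1,3) ghomD[OF q] by (auto simp: nerve_simplices_def P_proj_simplex_def)
qed

text \<open>The base \<open>x\<close> is the first vertex of the simplex. The lift starts with its
  identity and continues with the morphisms \<open>f (0, j)\<close>; the composition rule of the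
  nerve returns every other \<open>f (i, j)\<close> as a quotient.\<close>

lemma nerve_simplex_lift:
  assumes \<tau>: "\<tau> \<in> nerve_simplices G H"
  obtains x ps where "ps \<in> P_simplices G H x" "P_proj_simplex G ps = \<tau>"
proof -
  obtain xs f where \<tau>': "\<tau> = (xs, f)" by fastforce
  have xs: "xs \<noteq> []" "set xs \<subseteq> gobj G"
    and f: "\<And>i j. i < j \<Longrightarrow> j < length xs \<Longrightarrow> f (i, j) \<in> H \<and> f (i, j) \<in> ghom G (xs ! i) (xs ! j)"
    and comp: "\<And>i j k. i < j \<Longrightarrow> j < k \<Longrightarrow> k < length xs \<Longrightarrow> gcomp G (f (j, k)) (f (i, j)) = f (i, k)"
    and undef: "\<And>i j. \<not> (i < j \<and> j < length xs) \<Longrightarrow> f (i, j) = undefined"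
    using \<tau> gen unfolding nerve_simplices_def \<tau>' generates_def ghom_def by auto
  define p where "p j = (if j = 0 then gid G (xs ! 0) else f (0, j))" for j
  let ?ps = "map p [0..<length xs]"
  have x0: "xs ! 0 \<in> gobj G" using xs by auto
  have p: "p j \<in> ghom G (xs ! 0) (xs ! j)" if "j < length xs" for j
    using f[of 0 j] id_ghom[OF x0] that by (auto simp: p_def)
  have pf: "gcomp G (p j) (ginv G (p i)) = f (i, j)" if ij: "i < j" "j < length xs" for i j
  proof (cases "i = 0")
    case True
    then show ?thesis using inv_id[OF x0] comp_id(1) f[OF ij] ij by (auto simp: p_def)
  next
    case False
    then show ?thesis
      using inv_comp_cancel(3)[OF conjunct2[OF f[of 0 i]] conjunct2[OF f[OF ij]]] comp[of 0 i j] ij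
      by (simp add: p_def)
  qed
  have "?ps \<in> P_simplices G H (xs ! 0)"
    using xs p pf f by (intro P_simplicesI) auto
  moreover have "P_proj_simplex G ?ps = \<tau>"
    using ghomD(3)[OF p] pf undef by (auto simp: P_proj_simplex_def \<tau>' fun_eq_iff intro!: nth_equalityI)
  ultimately show ?thesis using that by blast
qed

text \<open>A quotient of two vertices together with one of them determines the other, so the common
  vertex at position \<open>k\<close> fixes all vertices before and after it.\<close>

lemma P_proj_simplex_inj:
  assumes ps: "ps \<in> P_simplices G H X" "ps' \<in> P_simplices G H X"
    and eq: "P_proj_simplex G ps = P_proj_simplex G ps'"
    and k: "k < length ps" "ps ! k = ps' ! k"
  shows "ps = ps'"
proof (rule nth_equalityI)
  note D = P_simplicesD[OF ps(1)] and D' = P_simplicesD[OF ps(2)]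
  have "map (gtgt G) ps = map (gtgt G) ps'" using eq by (simp add: P_proj_simplex_def)
  then show len: "length ps = length ps'" by (rule map_eq_imp_length_eq)
  have quot: "gcomp G (ps ! j) (ginv G (ps ! i)) = gcomp G (ps' ! j) (ginv G (ps' ! i))"
    if "i < j" "j < length ps" for i j
    using arg_cong[OF eq, of "\<lambda>s. snd s (i, j)"] that len by (simp add: P_proj_simplex_def)
  fix i assume i: "i < length ps"
  note h = D(2)[OF i] D'(2)[OF i[unfolded len]] D(2)[OF k(1)]
  consider "i = k" | "k < i" | "i < k" by linarith
  then show "ps ! i = ps' ! i"
  proof cases
    case 2
    then show ?thesis
      using quot[OF 2 i] k(2) inv_comp_cancel(4) h inv_ghom by metis
  next
    case 3
    then have "gcomp G (ps ! k) (ginv G (ps ! i)) = gcomp G (ps ! k) (ginv G (ps' ! i))"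
      using quot[OF 3 k(1)] k(2) by simp
    then have "ginv G (ps ! i) = ginv G (ps' ! i)"
      using inv_comp_cancel(1)[OF h(3)] inv_ghom[OF h(1)] inv_ghom[OF h(2)] by metis
    then show ?thesis using inv_inv h by metis
  qed (use k in simp)
qed

lemma map_nth_in_P_simplices:
  assumes ps: "ps \<in> P_simplices G H X" and I: "I \<subseteq> {..length ps - 1}" "I \<noteq> {}"
  shows "map ((!) ps) (sorted_list_of_set I) \<in> P_simplices G H X"
proof (rule P_simplicesI)
  note D = P_simplicesD[OF ps]
  have fin: "finite I" using I(1) finite_subset by blast
  have l: "nth_elem I k < length ps" if "k < card I" for k
    using nth_elem_in[OF fin that] I(1) D(1) by (cases ps) auto
  show "map ((!) ps) (sorted_list_of_set I) \<noteq> []" using I fin by simp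
  show "\<exists>y. map ((!) ps) (sorted_list_of_set I) ! i \<in> ghom G X y"
    if "i < length (map ((!) ps) (sorted_list_of_set I))" for i
    using that D(2)[OF l] by auto
  show "gcomp G (map ((!) ps) (sorted_list_of_set I) ! j) (ginv G (map ((!) ps) (sorted_list_of_set I) ! i)) \<in> H"
    if "i < j" "j < length (map ((!) ps) (sorted_list_of_set I))" for i j
    using that D(3)[OF nth_elem_less[OF fin] l] by auto
qed

lemma map_nth_nth_elem:
  assumes "finite I" "K \<subseteq> {..<card I}"
  shows "map ((!) (map ((!) ps) (sorted_list_of_set I))) (sorted_list_of_set K) =
    map ((!) ps) (sorted_list_of_set (nth_elem I ` K))"
proof -
  have "finite K" using assms(2) finite_subset by blast
  then show ?thesis
    using assms by (auto simp: sorted_list_of_set_nth_elem_image)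
qed

lemma delta_complex_P: "delta_complex (P_simplices G H X) (\<lambda>ps. length ps - 1) (\<lambda>ps i. del_nth i ps)"
proof
  fix ps I assume ps: "ps \<in> P_simplices G H X" and I: "I \<subseteq> {..length ps - 1}"
  note d = dface_del_nth[OF P_simplicesD(1)[OF ps] I]
  have fin: "finite I" using I finite_subset by blast
  show "dface (\<lambda>ps i. del_nth i ps) (length ps - 1) ps I \<in> P_simplices G H X" if "I \<noteq> {}"
    unfolding d by (rule map_nth_in_P_simplices[OF ps I that])
  show "length (dface (\<lambda>ps i. del_nth i ps) (length ps - 1) ps I) - 1 = card I - 1"
    unfolding d by simp
  fix K assume K: "K \<subseteq> {..<card I}" "K \<noteq> {}"
  have K': "map ((!) ps) (sorted_list_of_set I) \<noteq> []" "K \<subseteq> {..length (map ((!) ps) (sorted_list_of_set I)) - 1}"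
    using K fin by (auto simp: subset_iff)
  have "nth_elem I ` K \<subseteq> {..length ps - 1}"
    using nth_elem_in[OF fin] I K by auto
  from dface_del_nth[OF P_simplicesD(1)[OF ps] this]
  show "dface (\<lambda>ps i. del_nth i ps) (card I - 1) (dface (\<lambda>ps i. del_nth i ps) (length ps - 1) ps I) K =
    dface (\<lambda>ps i. del_nth i ps) (length ps - 1) ps (nth_elem I ` K)"
    using dface_del_nth[OF K'] map_nth_nth_elem[OF fin K(1), of ps]
    unfolding d by simp
qed

lemma nerve_dim_P_proj_simplex [simp]: "nerve_dim (P_proj_simplex G ps) = length ps - 1"
  by (simp add: nerve_dim_def P_proj_simplex_def)

lemma delta_complex_nerve: "delta_complex (nerve_simplices G H) nerve_dim nerve_face"
proof
  fix \<tau> I assume \<tau>: "\<tau> \<in> nerve_simplices G H" and I: "I \<subseteq> {..nerve_dim \<tau>}"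
  obtain x ps where ps: "ps \<in> P_simplices G H x" "\<tau> = P_proj_simplex G ps"
    using nerve_simplex_lift[OF \<tau>] by metis
  have I': "I \<subseteq> {..length ps - 1}" using I ps(2) by simp
  note d = dface_nerve[OF P_simplicesD(1)[OF ps(1)] I']
  have fin: "finite I" using I finite_subset by blast
  show "dface nerve_face (nerve_dim \<tau>) \<tau> I \<in> nerve_simplices G H" if "I \<noteq> {}"
    using P_proj_simplex_in_nerve[OF map_nth_in_P_simplices[OF ps(1) I' that]]
    unfolding ps(2) nerve_dim_P_proj_simplex d .
  show "nerve_dim (dface nerve_face (nerve_dim \<tau>) \<tau> I) = card I - 1"
    unfolding ps(2) nerve_dim_P_proj_simplex d by simp
  fix K assume K: "K \<subseteq> {..<card I}" "K \<noteq> {}"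
  have K': "map ((!) ps) (sorted_list_of_set I) \<noteq> []" "K \<subseteq> {..length (map ((!) ps) (sorted_list_of_set I)) - 1}"
    using K fin by (auto simp: subset_iff)
  have "nth_elem I ` K \<subseteq> {..length ps - 1}"
    using nth_elem_in[OF fin] I' K by auto
  from dface_nerve[OF P_simplicesD(1)[OF ps(1)] this, of G]
  show "dface nerve_face (card I - 1) (dface nerve_face (nerve_dim \<tau>) \<tau> I) K =
    dface nerve_face (nerve_dim \<tau>) \<tau> (nth_elem I ` K)"
    using dface_nerve[OF K', of G] map_nth_nth_elem[OF fin K(1), of ps]
    unfolding ps(2) nerve_dim_P_proj_simplex d by simp
qed

text \<open>Some lift \<open>qs\<close> of \<open>\<tau>\<close> exists over a base
  \<open>x\<close>. It is translated so that one vertex of its face on \<open>J\<close> becomes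
  right; the rest of that face is then right by \<open>P_proj_simplex_inj\<close>.\<close>

lemma P_simplex_lift:
  assumes \<tau>: "\<tau> \<in> nerve_simplices G H" and J: "J \<subseteq> {..nerve_dim \<tau>}" "J \<noteq> {}"
    and \<sigma>: "\<sigma> \<in> P_simplices G H X" "P_proj_simplex G \<sigma> = dface nerve_face (nerve_dim \<tau>) \<tau> J"
  shows "\<exists>s\<in>P_simplices G H X. P_proj_simplex G s = \<tau> \<and> dface (\<lambda>ps i. del_nth i ps) (length s - 1) s J = \<sigma>"
proof -
  obtain x qs where qs: "qs \<in> P_simplices G H x" "\<tau> = P_proj_simplex G qs"
    using nerve_simplex_lift[OF \<tau>] by metis
  have J': "J \<subseteq> {..length qs - 1}" using J(1) qs(2) by simp
  have fin: "finite J" using J(1) finite_subset by blast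
  then have card: "0 < card J" using J(2) by (simp add: card_gt_0_iff)
  let ?r = "\<lambda>ps. map ((!) ps) (sorted_list_of_set J)"
  let ?k = "nth_elem J 0"
  have k: "?k < length qs"
    using nth_elem_in[OF fin card] J' P_simplicesD(1)[OF qs(1)] by (cases qs) auto
  have eq: "P_proj_simplex G \<sigma> = P_proj_simplex G (?r qs)"
    using \<sigma>(2) dface_nerve[OF P_simplicesD(1)[OF qs(1)] J'] qs(2) by simp
  then have t: "map (gtgt G) \<sigma> = map (gtgt G) (?r qs)" by (simp add: P_proj_simplex_def)
  then have len: "length \<sigma> = card J" using map_eq_imp_length_eq by fastforce
  have "gtgt G (\<sigma> ! 0) = gtgt G (qs ! ?k)"
    using arg_cong[OF t, of "\<lambda>l. l ! 0"] len card by simp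
  then have s0: "\<sigma> ! 0 \<in> ghom G X (gtgt G (qs ! ?k))"
    using P_simplicesD(2)[OF \<sigma>(1), of 0] len card by simp
  note qk = P_simplicesD(2)[OF qs(1) k]
  \<comment> \<open>Translation by \<open>\<psi>\<close> sends \<open>qs ! ?k\<close>, the first
    vertex of the face on \<open>J\<close>, to \<open>\<sigma> ! 0\<close>.\<close>
  define \<psi> where "\<psi> = gcomp G (ginv G (qs ! ?k)) (\<sigma> ! 0)"
  have \<psi>: "\<psi> \<in> ghom G X x" unfolding \<psi>_def using comp_ghom s0 inv_ghom[OF qk] by blast
  let ?s = "map (\<lambda>f. gcomp G f \<psi>) qs"
  note s = P_simplices_translate[OF qs(1) \<psi>]
  have lt: "j < length qs" if "j \<in> J" for j using J' P_simplicesD(1)[OF qs(1)] that by (cases qs) auto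
  have rs: "?r ?s = map (\<lambda>f. gcomp G f \<psi>) (?r qs)"
    using lt fin by auto
  have J'': "J \<subseteq> {..length ?s - 1}" using J' by simp
  have rqs: "?r qs \<in> P_simplices G H x" by (rule map_nth_in_P_simplices[OF qs(1) J' J(2)])
  have "?r ?s = \<sigma>"
  proof (rule P_proj_simplex_inj[of _ X _ 0])
    show "?r ?s \<in> P_simplices G H X" by (rule map_nth_in_P_simplices[OF s(1) J'' J(2)])
    show "P_proj_simplex G (?r ?s) = P_proj_simplex G \<sigma>"
      unfolding rs P_simplices_translate(2)[OF rqs \<psi>] eq ..
    show "?r ?s ! 0 = \<sigma> ! 0"
      using inv_comp_cancel(2)[OF qk s0] card k by (simp add: \<psi>_def)
  qed (use \<sigma> card in auto)
  then show ?thesis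
    using s qs(2) dface_del_nth[OF P_simplicesD(1)[OF s(1)] J''] by metis
qed

lemma delta_covering_P:
  "delta_covering (P_simplices G H X) (\<lambda>ps. length ps - 1) (\<lambda>ps i. del_nth i ps)
     (nerve_simplices G H) nerve_dim nerve_face (P_proj_simplex G)"
proof (intro delta_covering.intro delta_covering_axioms.intro delta_complex_P delta_complex_nerve
    P_proj_simplex_in_nerve nerve_dim_P_proj_simplex P_simplex_lift)
  fix ps I assume ps: "ps \<in> P_simplices G H X" and I: "I \<subseteq> {..length ps - 1}" "I \<noteq> {}"
  show "P_proj_simplex G (dface (\<lambda>ps i. del_nth i ps) (length ps - 1) ps I) =
    dface nerve_face (length ps - 1) (P_proj_simplex G ps) I"
    unfolding sub_face[OF P_simplicesD(1)[OF ps] I(1)] ..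
  fix ps' assume ps': "ps' \<in> P_simplices G H X" and eq: "P_proj_simplex G ps = P_proj_simplex G ps'"
    and d: "dface (\<lambda>ps i. del_nth i ps) (length ps - 1) ps I = dface (\<lambda>ps i. del_nth i ps) (length ps' - 1) ps' I"
  have len: "length ps = length ps'"
    using eq map_eq_imp_length_eq by (auto simp: P_proj_simplex_def)
  obtain i where i: "i \<in> I" using I(2) by blast
  then have "i < length ps" using I(1) P_simplicesD(1)[OF ps] by (cases ps) auto
  moreover have "ps ! i = ps' ! i"
    using d dface_del_nth[OF P_simplicesD(1)[OF ps] I(1)] dface_del_nth[OF P_simplicesD(1)[OF ps']] I(1) i len
      finite_subset[OF I(1)] by auto
  ultimately show "ps = ps'" using P_proj_simplex_inj[OF ps ps' eq] by blast
qed

lemma covering_map_P_proj: "covering_map (PComplex G H X) (Nerve G H) (P_proj G)"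
proof -
  interpret delta_covering "P_simplices G H X" "\<lambda>ps. length ps - 1" "\<lambda>ps i. del_nth i ps"
     "nerve_simplices G H" nerve_dim nerve_face "P_proj_simplex G"
    by (rule delta_covering_P)
  have "Fmap = P_proj G" by (simp add: fun_eq_iff Fmap_def P_proj_def)
  then show ?thesis using covering_map_Fmap by (simp add: PComplex_def Nerve_def)
qed

end

section \<open>Holonomy of paths in the nerve\<close>

definition pvertex :: "'m \<Rightarrow> 'm list \<times> (nat \<Rightarrow> real)" where
  "pvertex f = ([f], \<lambda>i. if i = 0 then 1 else 0)"

definition seg :: "real \<Rightarrow> nat \<Rightarrow> real" where
  "seg u = (\<lambda>i. if i = 0 then 1 - u else if i = 1 then u else 0)"

lemma seg_in_stdsimplex: "u \<in> {0..1} \<Longrightarrow> seg u \<in> stdsimplex 1"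
  by (auto simp: seg_def stdsimplex_def)

lemma pathin_seg: "pathin (subtopology (powertop_real UNIV) (stdsimplex 1)) seg"
proof -
  have "continuous_on {0..1} (\<lambda>u. seg u k)" for k
    by (cases "k = 0"; cases "k = 1") (auto simp: seg_def intro!: continuous_intros)
  then show ?thesis
    using seg_in_stdsimplex
    by (auto simp: pathin_def continuous_map_in_subtopology continuous_map_componentwise_UNIV)
qed

lemma char_pt_seg:
  "char_pt (\<lambda>ps i. del_nth i ps) 1 [a, b] (seg 0) = pvertex a"
  "char_pt (\<lambda>ps i. del_nth i ps) 1 [a, b] (seg 1) = pvertex b"
proof -
  have s: "supp 1 (seg 0) = {0}" "supp 1 (seg 1) = {1}"
    by (auto simp: supp_def seg_def split: if_splits)
  show "char_pt (\<lambda>ps i. del_nth i ps) 1 [a, b] (seg 0) = pvertex a"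
    "char_pt (\<lambda>ps i. del_nth i ps) 1 [a, b] (seg 1) = pvertex b"
    using dface_del_nth[of "[a, b]" "{0}"] dface_del_nth[of "[a, b]" "{1}"]
    unfolding char_pt_eq s by (auto simp: pvertex_def restr_def seg_def)
qed

context generated_groupoid
begin

lemma topspace_PComplex: "topspace (PComplex G H X) = rpoints (P_simplices G H X) (\<lambda>ps. length ps - 1)"
  unfolding PComplex_def by (rule delta_complex.topspace_realization[OF delta_complex_P])

lemma pvertex_in_topspace:
  assumes "f \<in> ghom G X x" shows "pvertex f \<in> topspace (PComplex G H X)"
  using assms by (auto simp: topspace_PComplex pvertex_def rpoints_def ostdsimplex_def stdsimplex_def ghom_def P_simplices_def)

lemma P_proj_pvertex:
  assumes "f \<in> ghom G X x" shows "P_proj G (pvertex f) = nvertex x"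
  using ghomD(3)[OF assms] by (auto simp: P_proj_def P_proj_simplex_def pvertex_def nvertex_def fun_eq_iff)

text \<open>This lets the end of a lifted path be read as a morphism: the fibre over a vertex of the
  nerve is a set of morphisms out of \<open>X\<close>.\<close>

lemma P_proj_eq_nvertexE:
  assumes "e \<in> topspace (PComplex G H X)" "P_proj G e = nvertex y"
  obtains f where "f \<in> ghom G X y" "e = pvertex f"
proof -
  obtain ps t where e: "e = (ps, t)" by fastforce
  have "map (gtgt G) ps = [y]" "t = (\<lambda>i. if i = 0 then 1 else 0)"
    using assms(2) by (auto simp: e P_proj_def P_proj_simplex_def nvertex_def)
  then obtain f where f: "ps = [f]" "gtgt G f = y" by auto
  have "ps \<in> P_simplices G H X"
    using assms(1) by (auto simp: e topspace_PComplex rpoints_def)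
  then have "f \<in> ghom G X y" using P_simplicesD(2)[of ps X 0] f by simp
  then show ?thesis using that f \<open>t = _\<close> by (simp add: e pvertex_def)
qed

lemma edge_mor_ghom: "snd e \<in> H \<Longrightarrow> edge_mor G e \<in> ghom G (gsrc G (edge_mor G e)) (gtgt G (edge_mor G e))"
  using H_ghom[of "snd e"] inv_ghom by (auto simp: edge_mor_def ghom_def)

lemma epath_ConsD:
  assumes "epath G H x (e # es) y"
  shows "edge_mor G e \<in> ghom G x (gtgt G (edge_mor G e))" "epath G H (gtgt G (edge_mor G e)) es y"
    "snd e \<in> H" "gsrc G (edge_mor G e) = x"
  using assms edge_mor_ghom[of e] by simp_all

lemma P_edge:
  assumes "a \<in> ghom G X x" "f \<in> H" "f \<in> ghom G x y" 
  shows "[a, gcomp G f a] \<in> P_simplices G H X" "P_proj_simplex G [a, gcomp G f a] = nedge G f"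
proof -
  have c: "gcomp G (gcomp G f a) (ginv G a) = f"
    using inv_comp_cancel(3)[OF assms(1,3)] .
  note fa = comp_ghom[OF assms(1,3)]
  show "[a, gcomp G f a] \<in> P_simplices G H X"
    using assms(1) fa c assms(2) by (intro P_simplicesI) (auto simp: less_Suc_eq nth_Cons')
  show "P_proj_simplex G [a, gcomp G f a] = nedge G f"
    using c ghomD(2,3)[OF assms(3)] ghomD(3)[OF assms(1)] ghomD(3)[OF fa]
    by (auto simp: P_proj_simplex_def nedge_def fun_eq_iff less_Suc_eq)
qed

lemma P_edge_path:
  assumes ab: "[a, b] \<in> P_simplices G H X" "P_proj_simplex G [a, b] = nedge G f"
  defines "q \<equiv> \<lambda>u. char_pt (\<lambda>ps i. del_nth i ps) 1 [a, b] (seg u)"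
  shows "pathin (PComplex G H X) q" "q 0 = pvertex a" "q 1 = pvertex b"
    "\<And>u. u \<in> {0..1} \<Longrightarrow> P_proj G (q u) = edge_path G (True, f) u"
proof -
  interpret delta_covering "P_simplices G H X" "\<lambda>ps. length ps - 1" "\<lambda>ps i. del_nth i ps"
     "nerve_simplices G H" nerve_dim nerve_face "P_proj_simplex G"
    by (rule delta_covering_P)
  show "pathin (PComplex G H X) q"
    using pathin_compose[OF pathin_seg, of "PComplex G H X" "char_pt (\<lambda>ps i. del_nth i ps) 1 [a, b]"]
      E.continuous_map_char_pt[OF ab(1)]
    by (simp add: PComplex_def q_def o_def)
  show "q 0 = pvertex a" "q 1 = pvertex b" by (simp_all only: q_def char_pt_seg)
  show "P_proj G (q u) = edge_path G (True, f) u" if "u \<in> {0..1}" for u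
    using Fmap_char_pt[OF ab(1), of "seg u"] seg_in_stdsimplex[OF that]
    by (simp add: ab(2) q_def edge_path_def Let_def P_proj_def Fmap_def seg_def)
qed

lemma edge_lift:
  assumes a: "a \<in> ghom G X x" and e: "snd e \<in> H" "gsrc G (edge_mor G e) = x"
  shows "\<exists>q. pathin (PComplex G H X) q \<and> (\<forall>u\<in>{0..1}. P_proj G (q u) = edge_path G e u) \<and>
     q 0 = pvertex a \<and> q 1 = pvertex (gcomp G (edge_mor G e) a)"
proof (cases "fst e")
  case True
  define f where "f = snd e"
  have e': "e = (True, f)" "edge_mor G e = f" using True by (auto simp: f_def edge_mor_def prod_eq_iff)
  have f: "f \<in> H" "f \<in> ghom G x (gtgt G f)"
    using e(1) H_ghom[of f] e(2)[unfolded e'(2)] by (simp_all add: f_def)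
  show ?thesis
    using P_edge_path[OF P_edge[OF a f]] unfolding e'(2) unfolding e'(1) by blast
next
  case False
  define f where "f = snd e"
  have e': "e = (False, f)" "edge_mor G e = ginv G f" using False by (auto simp: f_def edge_mor_def prod_eq_iff)
  have "f \<in> H" using e(1) by (simp add: f_def)
  moreover have "gtgt G f = x"
    using ghomD(2)[OF inv_ghom[OF H_ghom[OF \<open>f \<in> H\<close>]]] e(2) e'(2) by simp
  ultimately have f: "f \<in> H" "f \<in> ghom G (gsrc G f) x"
    using H_ghom[of f] by simp_all
  \<comment> \<open>A backward edge is lifted by reversing a lift of the forward edge
    \<open>f\<close>. That lift has to end at \<open>a\<close>, so it starts at the inverse of
    \<open>f\<close> composed with \<open>a\<close>.\<close>
  let ?b = "gcomp G (ginv G f) a"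
  have b: "?b \<in> ghom G X (gsrc G f)" "gcomp G f ?b = a"
    using comp_ghom[OF a inv_ghom[OF f(2)]] inv_comp_cancel(2)[OF f(2) a] by auto
  obtain q where q: "pathin (PComplex G H X) q" "q 0 = pvertex ?b" "q 1 = pvertex a"
    "\<And>u. u \<in> {0..1} \<Longrightarrow> P_proj G (q u) = edge_path G (True, f) u"
    using P_edge_path[OF P_edge[OF b(1) f]] unfolding b(2) by blast
  have "edge_path G e u = edge_path G (True, f) (1 - u)" for u
    by (simp add: edge_path_def e' Let_def)
  then show ?thesis
    using q pathin_reverse[OF q(1)] e'(2) by (intro exI[of _ "\<lambda>u. q (1 - u)"]) auto
qed

lemma edge_path_ex:
  assumes "f \<in> ghom G x y" obtains es where "epath G H x es y" "ecomp G x es = f"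
proof -
  have "\<exists>es. epath G H (gsrc G f) es (gtgt G f) \<and> ecomp G (gsrc G f) es = f"
    using gen ghomD(1)[OF assms] unfolding generates_def by blast
  then show ?thesis using that ghomD(2,3)[OF assms] by blast
qed

text \<open>The accumulator is generalized from an identity to an arbitrary \<open>a\<close> to make
  the induction work. Source and target of \<open>ecomp\<close> come along in the same induction
  because associativity needs them.\<close>

lemma foldl_edges:
  assumes "epath G H y es z" "a \<in> ghom G x y"
  shows "foldl (\<lambda>acc e. gcomp G (edge_mor G e) acc) a es = gcomp G (ecomp G y es) a \<and> ecomp G y es \<in> ghom G y z"
  using assms
proof (induction es arbitrary: a x y)
  case Nil
  then show ?case using comp_id id_ghom by (auto simp: ecomp_def)
next
  case (Cons e es)
  let ?m = "edge_mor G e"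
  have m: "?m \<in> ghom G y (gtgt G ?m)" and es: "epath G H (gtgt G ?m) es z"
    using epath_ConsD[OF Cons.prems(1)] by blast+
  note y = id_ghom[OF ghomD(5)[OF Cons.prems(2)]]
  have r: "ecomp G (gtgt G ?m) es \<in> ghom G (gtgt G ?m) z"
    and c: "ecomp G y (e # es) = gcomp G (ecomp G (gtgt G ?m) es) ?m"
    using Cons.IH[OF es m] comp_id(1)[OF m] by (simp_all add: ecomp_def)
  show ?case
    using Cons.IH[OF es comp_ghom[OF Cons.prems(2) m]] comp_assoc[OF Cons.prems(2) m r] comp_ghom[OF m r]
    by (simp add: c)
qed

lemma ecomp_ghom:
  assumes "epath G H x es y" shows "x \<in> gobj G" "ecomp G x es \<in> ghom G x y"
proof -
  show x: "x \<in> gobj G"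
    using assms ghomD(4)[OF epath_ConsD(1)] by (cases es) (auto simp del: epath.simps(2))
  show "ecomp G x es \<in> ghom G x y" using foldl_edges[OF assms id_ghom[OF x]] by blast
qed

lemma ecomp_Cons:
  assumes "epath G H x (e # es) y"
  shows "ecomp G x (e # es) = gcomp G (ecomp G (gtgt G (edge_mor G e)) es) (edge_mor G e)"
  using foldl_edges[OF epath_ConsD(2,1)[OF assms]] comp_id(1)[OF epath_ConsD(1)[OF assms]]
  by (simp add: ecomp_def)

lemma edge_path_lift:
  assumes "epath G H x es y" "a \<in> ghom G X x"
  shows "\<exists>q. pathin (PComplex G H X) q \<and> (\<forall>u\<in>{0..1}. P_proj G (q u) = erealize G x es u) \<and>
     q 0 = pvertex a \<and> q 1 = pvertex (gcomp G (ecomp G x es) a)"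
  using assms
proof (induction es arbitrary: a x)
  case Nil
  then show ?case
    using pvertex_in_topspace[OF Nil(2)] P_proj_pvertex[OF Nil(2)] comp_id(2)[OF Nil(2)]
    by (intro exI[of _ "\<lambda>_. pvertex a"]) (auto simp: ecomp_def)
next
  case (Cons e es)
  let ?m = "edge_mor G e"
  have m: "?m \<in> ghom G x (gtgt G ?m)" and es: "epath G H (gtgt G ?m) es y"
    using epath_ConsD[OF Cons.prems(1)] by blast+
  note ma = comp_ghom[OF Cons.prems(2) m]
  obtain q where q: "pathin (PComplex G H X) q" "\<forall>u\<in>{0..1}. P_proj G (q u) = edge_path G e u"
    "q 0 = pvertex a" "q 1 = pvertex (gcomp G ?m a)"
    using edge_lift[OF Cons.prems(2) epath_ConsD(3,4)[OF Cons.prems(1)]] by blast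
  obtain r where r: "pathin (PComplex G H X) r" "\<forall>u\<in>{0..1}. P_proj G (r u) = erealize G (gtgt G ?m) es u"
    "r 0 = pvertex (gcomp G ?m a)" "r 1 = pvertex (gcomp G (ecomp G (gtgt G ?m) es) (gcomp G ?m a))"
    using Cons.IH[OF es ma] by blast
  have "gcomp G (ecomp G x (e # es)) a = gcomp G (ecomp G (gtgt G ?m) es) (gcomp G ?m a)"
    using ecomp_Cons[OF Cons.prems(1)] comp_assoc[OF Cons.prems(2) m ecomp_ghom(2)[OF es]] by simp
  moreover have "P_proj G (pjoin q r u) = erealize G x (e # es) u" if "u \<in> {0..1}" for u
    using that q(2)[THEN bspec, of "2 * u"] r(2)[THEN bspec, of "2 * u - 1"] by (auto simp: pjoin_def)
  moreover have "pathin (PComplex G H X) (pjoin q r)"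
    using pathin_pjoin[OF q(1) r(1)] q(4) r(3) by simp
  moreover have "pjoin q r 0 = q 0" "pjoin q r 1 = r 1" by (simp_all add: pjoin_def)
  ultimately show ?case using q(3) r(4) by metis
qed

section \<open>Monodromy and the evaluation of \<open>omega\<close>\<close>

text \<open>This is the monodromy of the covering, written as a relation so that no lift has to be
  chosen. Existence and homotopy invariance of the end are \<open>holonomy_exists\<close> and
  \<open>holonomy_homotopic\<close>.\<close>

definition holonomy :: "'o \<Rightarrow> (real \<Rightarrow> ('o list \<times> (nat \<times> nat \<Rightarrow> 'm)) \<times> (nat \<Rightarrow> real)) \<Rightarrow> 'm \<Rightarrow> 'm \<Rightarrow> bool" where
  "holonomy X p a b \<longleftrightarrow> (\<exists>q. pathin (PComplex G H X) q \<and> (\<forall>u\<in>{0..1}. P_proj G (q u) = p u) \<and>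
     q 0 = pvertex a \<and> q 1 = pvertex b)"

lemma pvertex_eq_iff [simp]: "pvertex a = pvertex b \<longleftrightarrow> a = b"
  by (simp add: pvertex_def)

lemma holonomy_exists:
  assumes "pathin (Nerve G H) p" "p 0 = nvertex x" "p 1 = nvertex y" "a \<in> ghom G X x"
  obtains b where "b \<in> ghom G X y" "holonomy X p a b"
proof -
  obtain q where q: "pathin (PComplex G H X) q" "\<forall>u\<in>{0..1}. P_proj G (q u) = p u" "q 0 = pvertex a"
    using covering_map_lift_path[OF covering_map_P_proj assms(1) pvertex_in_topspace[OF assms(4)]]
      P_proj_pvertex[OF assms(4)] assms(2) by auto
  obtain b where "b \<in> ghom G X y" "q 1 = pvertex b"
    using P_proj_eq_nvertexE[OF path_finish_in_topspace[OF q(1)]] q(2) assms(3) by auto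
  then show ?thesis using that q unfolding holonomy_def by blast
qed

lemma holonomy_pathin:
  assumes "holonomy X p a b" shows "pathin (Nerve G H) p"
proof -
  obtain q where q: "pathin (PComplex G H X) q" "\<forall>u\<in>{0..1}. P_proj G (q u) = p u"
    using assms unfolding holonomy_def by blast
  have "pathin (Nerve G H) (P_proj G \<circ> q)"
    by (rule pathin_compose[OF q(1) covering_map_continuous[OF covering_map_P_proj]])
  then show ?thesis
    unfolding pathin_def by (rule continuous_map_eq) (use q(2) in simp)
qed

lemma holonomy_homotopic:
  assumes "holonomy X p a b" "holonomy X p' a b'" "homotopic_paths_in (Nerve G H) p p'"
  shows "b = b'"
proof -
  obtain q q' where q: "pathin (PComplex G H X) q" "\<And>u. u \<in> {0..1} \<Longrightarrow> P_proj G (q u) = p u"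
      "q 0 = pvertex a" "q 1 = pvertex b"
    and q': "pathin (PComplex G H X) q'" "\<And>u. u \<in> {0..1} \<Longrightarrow> P_proj G (q' u) = p' u"
      "q' 0 = pvertex a" "q' 1 = pvertex b'"
    using assms(1,2) unfolding holonomy_def by blast
  have "q 1 = q' 1"
    by (rule covering_map_homotopic_lifts_end[OF covering_map_P_proj assms(3) q(1,2) q'(1,2)])
      (simp_all add: q(3) q'(3))
  then show ?thesis by (simp add: q(4) q'(4))
qed

text \<open>Simple connectivity enters here: the two lifts have the same ends, so they are homotopic
  upstairs, and the homotopy is projected.\<close>

lemma homotopic_if_holonomy_eq:
  assumes "simply_connected_space (PComplex G H X)" "holonomy X p a b" "holonomy X p' a b"
  shows "homotopic_paths_in (Nerve G H) p p'"
proof -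
  obtain q q' where q: "pathin (PComplex G H X) q" "\<forall>u\<in>{0..1}. P_proj G (q u) = p u" "q 0 = pvertex a" "q 1 = pvertex b"
    and q': "pathin (PComplex G H X) q'" "\<forall>u\<in>{0..1}. P_proj G (q' u) = p' u" "q' 0 = pvertex a" "q' 1 = pvertex b"
    using assms(2,3) unfolding holonomy_def by blast
  have "homotopic_paths_in (PComplex G H X) q q'"
    using simply_connected_space_homotopic_paths[OF assms(1) q(1) q'(1)] q q' by simp
  from homotopic_paths_in_image[OF this covering_map_continuous[OF covering_map_P_proj]]
  have "homotopic_paths_in (Nerve G H) (P_proj G \<circ> q) (P_proj G \<circ> q')" .
  moreover have "homotopic_paths_in (Nerve G H) p (P_proj G \<circ> q)" "homotopic_paths_in (Nerve G H) p' (P_proj G \<circ> q')"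
    using homotopic_paths_in_eq[OF holonomy_pathin[OF assms(2)]] homotopic_paths_in_eq[OF holonomy_pathin[OF assms(3)]]
      q(2) q'(2) by auto
  ultimately show ?thesis
    by (blast intro: homotopic_paths_in_trans homotopic_paths_in_sym)
qed

lemma holonomy_pjoin:
  assumes "holonomy X p a b" "holonomy X p' b c" shows "holonomy X (pjoin p p') a c"
proof -
  obtain q q' where "pathin (PComplex G H X) q" "\<forall>u\<in>{0..1}. P_proj G (q u) = p u" "q 0 = pvertex a" "q 1 = pvertex b"
    and "pathin (PComplex G H X) q'" "\<forall>u\<in>{0..1}. P_proj G (q' u) = p' u" "q' 0 = pvertex b" "q' 1 = pvertex c"
    using assms unfolding holonomy_def by blast
  then show ?thesis
    unfolding holonomy_def using pathin_pjoin[of "PComplex G H X" q q']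
    by (intro exI[of _ "pjoin q q'"]) (auto simp: pjoin_def)
qed

lemma holonomy_erealize:
  assumes "epath G H x es y" "a \<in> ghom G X x"
  shows "holonomy X (erealize G x es) a (gcomp G (ecomp G x es) a)"
  using edge_path_lift[OF assms] unfolding holonomy_def .

text \<open>The ends are read off from the lift, which starts and ends in vertices, without
  unfolding the realized edges.\<close>

lemma erealize_ends:
  assumes "epath G H x es y" "a \<in> ghom G X x"
  shows "erealize G x es 0 = nvertex x" "erealize G x es 1 = nvertex y"
proof -
  obtain q where q: "\<forall>u\<in>{0..1}. P_proj G (q u) = erealize G x es u"
     "q 0 = pvertex a" "q 1 = pvertex (gcomp G (ecomp G x es) a)"
    using edge_path_lift[OF assms] by blast
  then show "erealize G x es 0 = nvertex x" "erealize G x es 1 = nvertex y"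
    using P_proj_pvertex[OF assms(2)] P_proj_pvertex[OF comp_ghom[OF assms(2) ecomp_ghom(2)[OF assms(1)]]]
      q(1)[THEN bspec, of 0] q(1)[THEN bspec, of 1] by simp_all
qed

text \<open>This evaluates the description under \<open>THE\<close> in \<open>omega\<close>. By
  homotopy invariance the composite \<open>f\<close> of any edge path in the class satisfies
  \<open>f a = b\<close>. Conversely, generation provides an edge path with composite
  \<open>b a^{-1}\<close>, and equal monodromy at \<open>a\<close> puts it into the class.\<close>

lemma edge_paths_in_class:
  assumes sc: "simply_connected_space (PComplex G H X)"
    and a: "a \<in> ghom G X x" and b: "b \<in> ghom G X y" and p: "holonomy X p a b"
  shows "(\<exists>es. epath G H x es y \<and> erealize G x es \<in> pclass (Nerve G H) p \<and> ecomp G x es = f) \<longleftrightarrow>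
    f = gcomp G b (ginv G a)"
proof
  assume "\<exists>es. epath G H x es y \<and> erealize G x es \<in> pclass (Nerve G H) p \<and> ecomp G x es = f"
  then obtain es where es: "epath G H x es y" "homotopic_paths_in (Nerve G H) p (erealize G x es)" "ecomp G x es = f"
    by (auto simp: pclass_def)
  have "b = gcomp G f a"
    using holonomy_homotopic[OF p holonomy_erealize[OF es(1) a] es(2)] es(3) by simp
  then show "f = gcomp G b (ginv G a)"
    using inv_comp_cancel(3)[OF a] ecomp_ghom(2)[OF es(1)] es(3) by simp
next
  assume f: "f = gcomp G b (ginv G a)"
  have f_hom: "f \<in> ghom G x y" unfolding f using comp_ghom[OF inv_ghom[OF a] b] .
  then obtain es where es: "epath G H x es y" "ecomp G x es = f"
    by (rule edge_path_ex)
  have "gcomp G f a = b" unfolding f using inv_comp_cancel(4)[OF a b] .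
  then have "homotopic_paths_in (Nerve G H) p (erealize G x es)"
    using homotopic_if_holonomy_eq[OF sc p] holonomy_erealize[OF es(1) a] es(2) by simp
  then show "\<exists>es. epath G H x es y \<and> erealize G x es \<in> pclass (Nerve G H) p \<and> ecomp G x es = f"
    using es by (auto simp: pclass_def)
qed

text \<open>The start \<open>a\<close> over \<open>x\<close> is arbitrary, so each path can be
  evaluated from whatever start is convenient.\<close>

lemma omega_pclass:
  assumes "simply_connected_space (PComplex G H X)" "a \<in> ghom G X x" "b \<in> ghom G X y" "holonomy X p a b"
  shows "omega G H x y (pclass (Nerve G H) p) = gcomp G b (ginv G a)"
  unfolding omega_def edge_paths_in_class[OF assms] by simp

lemma fhomE:
  assumes "c \<in> fhom (Nerve G H) (nvertex x) (nvertex y)" "a \<in> ghom G X x"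
  obtains p b where "c = pclass (Nerve G H) p" "b \<in> ghom G X y" "holonomy X p a b"
proof -
  obtain p where p: "c = pclass (Nerve G H) p" "pathin (Nerve G H) p" "p 0 = nvertex x" "p 1 = nvertex y"
    using assms(1) unfolding fhom_def by blast
  show ?thesis using holonomy_exists[OF p(2-4) assms(2)] that[OF p(1)] by blast
qed

lemma edge_paths_homotopic:
  assumes "simply_connected_space (PComplex G H X)" "a \<in> ghom G X x"
    "epath G H x es1 y" "epath G H x es2 y" "ecomp G x es1 = ecomp G x es2"
  shows "homotopic_paths_in (Nerve G H) (erealize G x es1) (erealize G x es2)"
  by (rule homotopic_if_holonomy_eq[OF assms(1) holonomy_erealize[OF assms(3,2)]])
    (use holonomy_erealize[OF assms(4,2)] assms(5) in simp)

text \<open>For a fixed start \<open>a\<close>, the value \<open>b a^{-1}\<close> and the end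
  \<open>b\<close> determine each other, and \<open>b\<close> determines the class. Surjectivity is
  generation by \<open>H\<close>.\<close>

lemma bij_betw_omega:
  assumes sc: "simply_connected_space (PComplex G H X)" and a: "a \<in> ghom G X x"
  shows "bij_betw (omega G H x y) (fhom (Nerve G H) (nvertex x) (nvertex y)) (ghom G x y)"
  unfolding bij_betw_def
proof
  let ?F = "fhom (Nerve G H) (nvertex x) (nvertex y)"
  note om = omega_pclass[OF sc a]
  show "inj_on (omega G H x y) ?F"
  proof (rule inj_onI)
    fix c c' assume c: "c \<in> ?F" "c' \<in> ?F" and eq: "omega G H x y c = omega G H x y c'"
    obtain p b where p: "c = pclass (Nerve G H) p" "b \<in> ghom G X y" "holonomy X p a b"
      using fhomE[OF c(1) a] .
    obtain p' b' where p': "c' = pclass (Nerve G H) p'" "b' \<in> ghom G X y" "holonomy X p' a b'"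
      using fhomE[OF c(2) a] .
    have "gcomp G b (ginv G a) = gcomp G b' (ginv G a)"
      using om[OF p(2,3)] om[OF p'(2,3)] eq p(1) p'(1) by simp
    then have "b = b'"
      using inv_comp_cancel(4)[OF a p(2)] inv_comp_cancel(4)[OF a p'(2)] by metis
    then show "c = c'"
      using homotopic_if_holonomy_eq[OF sc p(3)] p'(3) pclass_eq_iff[OF holonomy_pathin[OF p(3)]] p(1) p'(1)
      by simp
  qed
  show "omega G H x y ` ?F = ghom G x y"
  proof
    show "omega G H x y ` ?F \<subseteq> ghom G x y"
    proof (rule image_subsetI)
      fix c assume "c \<in> ?F"
      then obtain p b where p: "c = pclass (Nerve G H) p" "b \<in> ghom G X y" "holonomy X p a b"
        using fhomE[OF _ a] by blast
      then show "omega G H x y c \<in> ghom G x y"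
        using om comp_ghom[OF inv_ghom[OF a]] by simp
    qed
    show "ghom G x y \<subseteq> omega G H x y ` ?F"
    proof
      fix f assume f: "f \<in> ghom G x y"
      then obtain es where es: "epath G H x es y" "ecomp G x es = f"
        by (rule edge_path_ex)
      note hol = holonomy_erealize[OF es(1) a, unfolded es(2)]
      have "omega G H x y (pclass (Nerve G H) (erealize G x es)) = f"
        using om[OF comp_ghom[OF a f] hol] inv_comp_cancel(3)[OF a f] by simp
      moreover have "pclass (Nerve G H) (erealize G x es) \<in> ?F"
        unfolding fhom_def using holonomy_pathin[OF hol] erealize_ends[OF es(1) a] by blast
      ultimately show "f \<in> omega G H x y ` ?F" by blast
    qed
  qed
qed

lemma omega_pjoin:
  assumes sc: "simply_connected_space (PComplex G H X)" and a: "a \<in> ghom G X x"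
    and p: "pathin (Nerve G H) p" "p 0 = nvertex x" "p 1 = nvertex y"
    and q: "pathin (Nerve G H) q" "q 0 = nvertex y" "q 1 = nvertex z"
  shows "omega G H x z (pclass (Nerve G H) (pjoin p q)) =
     gcomp G (omega G H y z (pclass (Nerve G H) q)) (omega G H x y (pclass (Nerve G H) p))"
proof -
  obtain b where b: "b \<in> ghom G X y" "holonomy X p a b" using holonomy_exists[OF p a] .
  \<comment> \<open>The lift of \<open>q\<close> starts at the end \<open>b\<close> of the lift of
    \<open>p\<close>, so the inner factors cancel: \<open>b a^{-1}\<close> followed by
    \<open>c b^{-1}\<close> is \<open>c a^{-1}\<close>.\<close>
  obtain c where c: "c \<in> ghom G X z" "holonomy X q b c" using holonomy_exists[OF q b(1)] .
  have "omega G H x z (pclass (Nerve G H) (pjoin p q)) = gcomp G c (ginv G a)"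
    by (rule omega_pclass[OF sc a c(1) holonomy_pjoin[OF b(2) c(2)]])
  moreover have "gcomp G (gcomp G c (ginv G b)) (gcomp G b (ginv G a)) = gcomp G c (ginv G a)"
    using comp_assoc[OF comp_ghom[OF inv_ghom[OF a] b(1)] inv_ghom[OF b(1)] c(1)]
      inv_comp_cancel(1)[OF b(1) inv_ghom[OF a]] by simp
  ultimately show ?thesis
    using omega_pclass[OF sc a b] omega_pclass[OF sc b(1) c] by simp
qed

end

text \<open>The vertices of \<open>PComplex G H X\<close> are morphisms out of \<open>X\<close>, so
  this complex sees only the component of \<open>X\<close>, whose objects form \<open>C\<close>. The
  isomorphism is therefore stated there, and the property of all of \<open>G\<close> in the last
  clause under connectedness. The clause with unique existence makes the description in
  \<open>omega\<close> meaningful on each class.\<close>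

theorem mainTheorem6:
  fixes G :: "('o, 'm) groupoid" and H :: "'m set" and X :: 'o
  assumes "groupoid G" and "generates G H" and "X \<in> gobj G"
  shows "covering_map (PComplex G H X) (Nerve G H) (P_proj G)
    \<and> (simply_connected_space (PComplex G H X) \<longrightarrow>
        (let C = {y \<in> gobj G. ghom G X y \<noteq> {}}; N = Nerve G H in
          (\<forall>x\<in>C. \<forall>y\<in>C. \<forall>c\<in>fhom N (nvertex x) (nvertex y).
             \<exists>!f. \<exists>es. epath G H x es y \<and> erealize G x es \<in> c \<and> ecomp G x es = f)
        \<and> (\<forall>x\<in>C. \<forall>y\<in>C. bij_betw (omega G H x y) (fhom N (nvertex x) (nvertex y)) (ghom G x y))
        \<and> (\<forall>x\<in>C. \<forall>y\<in>C. \<forall>z\<in>C. \<forall>p q.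
             pathin N p \<and> p 0 = nvertex x \<and> p 1 = nvertex y \<and>
             pathin N q \<and> q 0 = nvertex y \<and> q 1 = nvertex z \<longrightarrow>
             omega G H x z (pclass N (pjoin p q)) =
               gcomp G (omega G H y z (pclass N q)) (omega G H x y (pclass N p)))
        \<and> (\<forall>x\<in>C. \<forall>y. \<forall>es1 es2. epath G H x es1 y \<and> epath G H x es2 y \<and>
             ecomp G x es1 = ecomp G x es2 \<longrightarrow>
             homotopic_paths_in N (erealize G x es1) (erealize G x es2))
        \<and> ((\<forall>y\<in>gobj G. ghom G X y \<noteq> {}) \<longrightarrow> homotopically_uniquely_generates G H)))"
proof -
  interpret generated_groupoid G H using assms by unfold_locales
  let ?C = "{y \<in> gobj G. ghom G X y \<noteq> {}}"
  show ?thesis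
    unfolding Let_def
  proof (intro conjI impI ballI allI)
    show "covering_map (PComplex G H X) (Nerve G H) (P_proj G)" by (rule covering_map_P_proj)
  next
    fix x y c assume sc: "simply_connected_space (PComplex G H X)" and "x \<in> ?C"
      and c: "c \<in> fhom (Nerve G H) (nvertex x) (nvertex y)"
    then obtain a where a: "a \<in> ghom G X x" by auto
    obtain p b where p: "c = pclass (Nerve G H) p" "b \<in> ghom G X y" "holonomy X p a b"
      using fhomE[OF c a] .
    show "\<exists>!f. \<exists>es. epath G H x es y \<and> erealize G x es \<in> c \<and> ecomp G x es = f"
      unfolding p(1) edge_paths_in_class[OF sc a p(2,3)] by simp
  next
    fix x y assume sc: "simply_connected_space (PComplex G H X)" and "x \<in> ?C"
    then show "bij_betw (omega G H x y) (fhom (Nerve G H) (nvertex x) (nvertex y)) (ghom G x y)"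
      using bij_betw_omega by blast
  next
    fix x y z p q
    assume sc: "simply_connected_space (PComplex G H X)" and "x \<in> ?C" 
      and "pathin (Nerve G H) p \<and> p 0 = nvertex x \<and> p 1 = nvertex y \<and>
             pathin (Nerve G H) q \<and> q 0 = nvertex y \<and> q 1 = nvertex z"
    then show "omega G H x z (pclass (Nerve G H) (pjoin p q)) =
       gcomp G (omega G H y z (pclass (Nerve G H) q)) (omega G H x y (pclass (Nerve G H) p))"
      using omega_pjoin by blast
  next
    fix x y es1 es2
    assume "simply_connected_space (PComplex G H X)" "x \<in> ?C"
      "epath G H x es1 y \<and> epath G H x es2 y \<and> ecomp G x es1 = ecomp G x es2"
    then show "homotopic_paths_in (Nerve G H) (erealize G x es1) (erealize G x es2)"
      using edge_paths_homotopic by blast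
  next
    \<comment> \<open>Connectedness supplies a start \<open>a\<close> over every object at which an
      edge path begins.\<close>
    assume "simply_connected_space (PComplex G H X)" "\<forall>y\<in>gobj G. ghom G X y \<noteq> {}"
    then show "homotopically_uniquely_generates G H"
      unfolding homotopically_uniquely_generates_def
      using gen edge_paths_homotopic ecomp_ghom(1) by blast
  qed
qed

end
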